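(* Let $G$ be a triangulated planar graph and let $\Gamma_1,\Gamma_2$ be straight-line planar drawings of $G$. Let $\mathcal M$ be a pseudo-morph of $G$ from $\Gamma_1$ to $\Gamma_2$ consisting of $k$ planar unidirectional steps (every linear morph in $\mathcal M$ is unidirectional and planar, and contractions and uncontractions each count as one step). If only vertices of degree at most $5$ are contracted in $\mathcal M$ (the degree being taken in the current graph at the moment of contraction), then there exists a planar morph from $\Gamma_1$ to $\Gamma_2$ consisting of $k$ unidirectional steps, i.e. there are straight-line planar drawings $\Gamma_1=\Delta_0,\Delta_1,\dots,\Delta_k=\Gamma_2$ of $G$ such that each linear morph from $\Delta_{j-1}$ to $\Delta_j$ ($1\le j\le k$) is unidirectional and planar.
   Context: A triangulated planar graph is a planar graph with a fixed combinatorial embedding all of whose faces, including the outer face, are triangles. The vertices of the outer face are called boundary vertices. All drawings of a graph realize its given embedding with the same outer face. A straight-line planar drawing places vertices at distinct points of the plane and edges as straight segments that meet only at common endpoints. Linear morph: given two straight-line drawings of the same graph, each vertex moves at constant speed along a straight segment from its position in the first drawing (time $t=0$) to its position in the second ($t=1$), and edges are drawn as straight segments at all times. It is planar if the drawing at every time $t\in[0,1]$ is straight-line planar. It is unidirectional ($L$-directional) if there are a line $L$ and a unit direction vector $\bar\ell$ of $L$ such that each vertex $v$ moves from its initial position $v_0$ to $v_0+k_v\bar\ell$ for some $k_v\in\mathbb R$ (of any sign, depending on $v$). Contraction: in a straight-line planar drawing of a triangulated planar graph, a non-boundary vertex $p$ is contracted to a neighbour $a$ by moving $p$ along the edge $pa$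 until it reaches $a$. The result is a drawing of the reduced graph obtained by deleting $p$ and joining $a$ to every other neighbour of $p$. The contraction is required to preserve planarity, i.e. the resulting drawing is a straight-line planar drawing of the reduced (triangulated) graph. An uncontraction of $p$ from $a$ is the reverse of a contraction of $p$ to $a$. Pseudo-morph: a pseudo-morph between two straight-line planar drawings of a graph is (recursively) a sequence of pieces leading from the first drawing to the second, where each piece is either (i) a planar linear morph, or (ii) a contraction of a vertex $p$ to a neighbour $a$, followed by a pseudo-morph between two drawings of the reduced graph, followed by an uncontraction of $p$ from $a$. The number of steps of a pseudo-morph is the total number of linear morphs, contractions and uncontractions in it. (A contraction or uncontraction moves only one vertex along a line, so it is regarded as a unidirectional step.) *)

theory Defs
  imports
    "HOL-Analysis.Analysis"
    "HOL-Combinatorics.Orbits"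
    "Graph_Theory.Graph_Theory"
begin

section \<open>Plane triangulations\<close>

text \<open>
  A finite simple graph is a symmetric loop-free digraph, each edge being a pair of opposite arcs.
  A combinatorial embedding is a rotation system: \<open>rot G v u\<close> is the neighbour of \<open>v\<close> that follows
  \<open>u\<close> in counterclockwise order around \<open>v\<close>. A face is the set of arcs with that face on their right;
  one of the faces is designated as the outer face.
\<close>

record 'v embedded_graph =
  graph :: "'v pair_pre_digraph"
  rot :: "'v \<Rightarrow> 'v \<Rightarrow> 'v"
  outer_face :: "('v \<times> 'v) set"

abbreviation vertices :: "'v embedded_graph \<Rightarrow> 'v set" where
  "vertices G \<equiv> pverts (graph G)"

abbreviation darts :: "'v embedded_graph \<Rightarrow> ('v \<times> 'v) set" where
  "darts G \<equiv> parcs (graph G)"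

definition neighbours :: "'v embedded_graph \<Rightarrow> 'v \<Rightarrow> 'v set" where
  "neighbours G v = {u. (v, u) \<in> darts G}"

abbreviation degree_of :: "'v embedded_graph \<Rightarrow> 'v \<Rightarrow> nat" where
  "degree_of G v \<equiv> out_degree (with_proj (graph G)) v"

definition face_step :: "'v embedded_graph \<Rightarrow> 'v \<times> 'v \<Rightarrow> 'v \<times> 'v" where
  "face_step G = (\<lambda>(u, v). (v, rot G v u))"

definition faces :: "'v embedded_graph \<Rightarrow> ('v \<times> 'v) set set" where
  "faces G = orbit (face_step G) ` darts G"

definition boundary :: "'v embedded_graph \<Rightarrow> 'v set" where
  "boundary G = fst ` outer_face G"

text \<open>
  Planarity of a connected combinatorial embedding is expressed by Euler's formula; since \<open>darts G\<close>
  contains every edge twice, the number of edges is half its cardinality. In a simple graph a face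
  consisting of three arcs is a triangle.
\<close>

definition plane_embedding :: "'v embedded_graph \<Rightarrow> bool" where
  "plane_embedding G \<longleftrightarrow>
     pair_graph (graph G) \<and>
     Digraph_Component.connected (with_proj (graph G)) \<and>
     (\<forall>v\<in>vertices G. cyclic_on (rot G v) (neighbours G v)) \<and>
     int (card (vertices G)) - int (card (darts G) div 2) + int (card (faces G)) = 2 \<and>
     outer_face G \<in> faces G"

definition triangulated_planar_graph :: "'v embedded_graph \<Rightarrow> bool" where
  "triangulated_planar_graph G \<longleftrightarrow> plane_embedding G \<and> (\<forall>F\<in>faces G. card F = 3)"

section \<open>Straight-line drawings\<close>

text \<open>
  The plane is \<^typ>\<open>complex\<close>. A drawing is a map from vertices to points; its values outside the
  vertex set are irrelevant.
\<close>

type_synonym 'v drawing = "'v \<Rightarrow> complex"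

definition straight_line_planar :: "'v embedded_graph \<Rightarrow> 'v drawing \<Rightarrow> bool" where
  "straight_line_planar G \<Gamma> \<longleftrightarrow>
     inj_on \<Gamma> (vertices G) \<and>
     (\<forall>(u, v)\<in>darts G. \<forall>(x, y)\<in>darts G. {u, v} \<noteq> {x, y} \<longrightarrow>
        closed_segment (\<Gamma> u) (\<Gamma> v) \<inter> closed_segment (\<Gamma> x) (\<Gamma> y) \<subseteq> \<Gamma> ` ({u, v} \<inter> {x, y}))"

definition ccw_angle :: "complex \<Rightarrow> complex \<Rightarrow> complex \<Rightarrow> real" where
  "ccw_angle c x y = Arg2pi ((y - c) / (x - c))"

definition realizes_rotation :: "'v embedded_graph \<Rightarrow> 'v drawing \<Rightarrow> bool" where
  "realizes_rotation G \<Gamma> \<longleftrightarrow>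
     (\<forall>v\<in>vertices G. \<forall>u\<in>neighbours G v. \<forall>w\<in>neighbours G v - {u}.
        ccw_angle (\<Gamma> v) (\<Gamma> u) (\<Gamma> (rot G v u)) \<le> ccw_angle (\<Gamma> v) (\<Gamma> u) (\<Gamma> w))"

definition skeleton :: "'v embedded_graph \<Rightarrow> 'v drawing \<Rightarrow> complex set" where
  "skeleton G \<Gamma> = (\<Union>(u, v)\<in>darts G. closed_segment (\<Gamma> u) (\<Gamma> v))"

text \<open>
  The outer face of \<open>G\<close> is drawn as the unbounded region: points slightly to the right of the
  midpoint of each of its arcs lie in the unbounded component of the complement of the drawing.
\<close>

definition realizes_outer_face :: "'v embedded_graph \<Rightarrow> 'v drawing \<Rightarrow> bool" where
  "realizes_outer_face G \<Gamma> \<longleftrightarrow>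
     (\<forall>(u, v)\<in>outer_face G. \<forall>\<^sub>F \<epsilon> in at_right (0::real).
        midpoint (\<Gamma> u) (\<Gamma> v) - of_real \<epsilon> * \<i> * (\<Gamma> v - \<Gamma> u) \<in> outside (skeleton G \<Gamma>))"

definition planar_drawing :: "'v embedded_graph \<Rightarrow> 'v drawing \<Rightarrow> bool" where
  "planar_drawing G \<Gamma> \<longleftrightarrow>
     straight_line_planar G \<Gamma> \<and> realizes_rotation G \<Gamma> \<and> realizes_outer_face G \<Gamma>"

section \<open>Linear morphs\<close>

definition linear_morph :: "'v drawing \<Rightarrow> 'v drawing \<Rightarrow> real \<Rightarrow> 'v drawing" where
  "linear_morph \<Gamma> \<Delta> t = (\<lambda>v. linepath (\<Gamma> v) (\<Delta> v) t)"

definition planar_linear_morph :: "'v embedded_graph \<Rightarrow> 'v drawing \<Rightarrow> 'v drawing \<Rightarrow> bool" where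
  "planar_linear_morph G \<Gamma> \<Delta> \<longleftrightarrow> (\<forall>t\<in>{0..1}. planar_drawing G (linear_morph \<Gamma> \<Delta> t))"

definition unidirectional :: "'v embedded_graph \<Rightarrow> 'v drawing \<Rightarrow> 'v drawing \<Rightarrow> bool" where
  "unidirectional G \<Gamma> \<Delta> \<longleftrightarrow>
     (\<exists>l. norm l = 1 \<and> (\<forall>v\<in>vertices G. \<exists>k::real. \<Delta> v = \<Gamma> v + k *\<^sub>R l))"

section \<open>Contractions\<close>

text \<open>
  Contracting \<open>p\<close> to \<open>a\<close> replaces \<open>p\<close>, in the rotation at \<open>a\<close>, by the neighbours of \<open>p\<close> in their
  order around \<open>p\<close> starting after \<open>a\<close>. In the rotation at another neighbour \<open>v\<close> of \<open>p\<close>, the entry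
  \<open>p\<close> becomes \<open>a\<close>; if \<open>v\<close> is already adjacent to \<open>a\<close>, then \<open>p\<close> and \<open>a\<close> are consecutive there (when
  \<open>v\<close>, \<open>p\<close>, \<open>a\<close> span a face) and the two entries merge. If \<open>p\<close> and \<open>a\<close> have common neighbours that
  do not span a face with them, the result is not a triangulated planar graph, and no
  such contraction is possible.
\<close>

definition contract :: "'v embedded_graph \<Rightarrow> 'v \<Rightarrow> 'v \<Rightarrow> 'v embedded_graph" where
  "contract G p a = \<lparr>
     graph = \<lparr>
       pverts = vertices G - {p},
       parcs = {(u, v) \<in> darts G. u \<noteq> p \<and> v \<noteq> p} \<union>
               {a} \<times> (neighbours G p - {a}) \<union> (neighbours G p - {a}) \<times> {a} \<rparr>,
     rot = (\<lambda>v u.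
       if v = a then
         (if u \<in> neighbours G p \<and> rot G p u \<noteq> a then rot G p u else rot G a u)
       else if u = a \<and> v \<in> neighbours G p \<and> (v \<notin> neighbours G a \<or> rot G v a = p) then rot G v p
       else if rot G v u = p then a
       else rot G v u),
     outer_face = outer_face G \<rparr>"

text \<open>
  \<open>contraction G \<Gamma> p a\<close>: the contraction of \<open>p\<close> to \<open>a\<close>, starting from the drawing \<open>\<Gamma>\<close> of \<open>G\<close>, is
  possible. The other vertices do not move, so its result is again \<open>\<Gamma>\<close>, now regarded as a drawing
  of \<open>contract G p a\<close>.
\<close>

definition contraction :: "'v embedded_graph \<Rightarrow> 'v drawing \<Rightarrow> 'v \<Rightarrow> 'v \<Rightarrow> bool" where
  "contraction G \<Gamma> p a \<longleftrightarrow>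
     p \<in> vertices G - boundary G \<and> a \<in> neighbours G p \<and> planar_drawing G \<Gamma> \<and>
     triangulated_planar_graph (contract G p a) \<and> planar_drawing (contract G p a) \<Gamma>"

section \<open>Pseudo-morphs\<close>

text \<open>
  A pseudo-morph is a list of pieces, ended by \<open>Stop\<close>. \<open>Linear \<Delta> M\<close> is a linear morph to \<open>\<Delta>\<close>
  followed by \<open>M\<close>. \<open>Detour p a N \<Delta> M\<close> is the contraction of \<open>p\<close> to \<open>a\<close>, the pseudo-morph \<open>N\<close> of the
  reduced graph and the uncontraction of \<open>p\<close> from \<open>a\<close> leading to \<open>\<Delta>\<close>, followed by \<open>M\<close>.
\<close>

datatype 'v pseudo_morph =
    Stop
  | Linear "'v drawing" "'v pseudo_morph"
  | Detour 'v 'v "'v pseudo_morph" "'v drawing" "'v pseudo_morph"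

primrec is_pseudo_morph ::
  "'v pseudo_morph \<Rightarrow> 'v embedded_graph \<Rightarrow> 'v drawing \<Rightarrow> 'v drawing \<Rightarrow> bool" where
  "is_pseudo_morph Stop G \<Gamma> \<Gamma>' \<longleftrightarrow> (\<forall>v\<in>vertices G. \<Gamma> v = \<Gamma>' v)"
| "is_pseudo_morph (Linear \<Delta> M) G \<Gamma> \<Gamma>' \<longleftrightarrow>
     planar_linear_morph G \<Gamma> \<Delta> \<and> is_pseudo_morph M G \<Delta> \<Gamma>'"
| "is_pseudo_morph (Detour p a N \<Delta> M) G \<Gamma> \<Gamma>' \<longleftrightarrow>
     contraction G \<Gamma> p a \<and> is_pseudo_morph N (contract G p a) \<Gamma> \<Delta> \<and> contraction G \<Delta> p a \<and>
     is_pseudo_morph M G \<Delta> \<Gamma>'"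

primrec steps :: "'v pseudo_morph \<Rightarrow> nat" where
  "steps Stop = 0"
| "steps (Linear \<Delta> M) = 1 + steps M"
| "steps (Detour p a N \<Delta> M) = 2 + steps N + steps M"

primrec unidirectional_steps ::
  "'v pseudo_morph \<Rightarrow> 'v embedded_graph \<Rightarrow> 'v drawing \<Rightarrow> bool" where
  "unidirectional_steps Stop G \<Gamma> \<longleftrightarrow> True"
| "unidirectional_steps (Linear \<Delta> M) G \<Gamma> \<longleftrightarrow>
     unidirectional G \<Gamma> \<Delta> \<and> unidirectional_steps M G \<Delta>"
| "unidirectional_steps (Detour p a N \<Delta> M) G \<Gamma> \<longleftrightarrow>
     unidirectional_steps N (contract G p a) \<Gamma> \<and> unidirectional_steps M G \<Delta>"

primrec contracted_degrees_le ::
  "nat \<Rightarrow> 'v pseudo_morph \<Rightarrow> 'v embedded_graph \<Rightarrow> bool" where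
  "contracted_degrees_le d Stop G \<longleftrightarrow> True"
| "contracted_degrees_le d (Linear \<Delta> M) G \<longleftrightarrow> contracted_degrees_le d M G"
| "contracted_degrees_le d (Detour p a N \<Delta> M) G \<longleftrightarrow>
     degree_of G p \<le> d \<and> contracted_degrees_le d N (contract G p a) \<and> contracted_degrees_le d M G"

end

theory Submission
  imports Defs
begin

text \<open>
  A map of the vertices of a plane triangulation to the plane is a planar drawing iff every inner
  face is drawn with the right orientation and the outer face with the opposite one. If planarity
  holds, an inner face drawn with the wrong orientation would have all edges at its corners start
  inside it, so it would contain the whole drawing, including the outer face. Conversely, the winding
  numbers of all faces around a generic point add up to zero, so a generic point of the outer
  triangle lies in exactly one inner face.

  Orientations are signs of determinants, which are affine in time during a unidirectional morph. So
  a piecewise unidirectional morph of the reduced graph lifts as soon as \<open>p\<close> is placed at every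
  intermediate drawing such that the faces at \<open>p\<close> are positive and \<open>p\<close> moves in the prescribed
  directions. Near \<open>a\<close>, the admissible positions of \<open>p\<close> form a cone bounded by two edges at \<open>a\<close>;
  its projection along the direction of a planar unidirectional morph is the same at both ends, so
  positions in consecutive cones can be linked, and scaling moves them all close to \<open>a\<close>. The
  contraction and the uncontraction become motions of \<open>p\<close> alone within the convex region where the
  faces at \<open>p\<close> are positive.
\<close>

subsection \<open>Oriented triangles in the plane\<close>

text \<open>\<open>ccw x y z\<close> is twice the signed area of a triangle. A face lies to the
  right of its darts, so its corners are read in the order \<open>v\<close>, \<open>u\<close>,
  \<open>third u v\<close> to make inner faces positive. The obstacle is that a pseudo-morph lets
  \<open>p\<close> coincide with \<open>a\<close>, where the two faces at the edge
  \<open>a p\<close> collapse. Only these two lose their sign: every other face at \<open>p\<close>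
  tends to a face of the reduced graph at \<open>a\<close>, whose sign is strict. Hence just two
  conditions survive near \<open>a\<close>, one for each common neighbour of \<open>a\<close> and
  \<open>p\<close>, and each is a half-plane through \<open>a\<close>. That there are exactly two
  common neighbours is forced by Euler's formula for both graphs. Both the cones and the links
  between consecutive cones are invariant under scaling, so a single small distance from
  \<open>a\<close> serves all of the finitely many stages.\<close>

definition ccw :: "complex \<Rightarrow> complex \<Rightarrow> complex \<Rightarrow> real" where
  "ccw x y z = Im (cnj (y - x) * (z - x))"

lemma ccw_rotate: "ccw x y z = ccw y z x"
  by (simp add: ccw_def algebra_simps)

lemma ccw_swap: "ccw y x z = - ccw x y z"
  by (simp add: ccw_def algebra_simps)

lemma ccw_degenerate [simp]: "ccw x x z = 0" "ccw x y x = 0" "ccw x y y = 0"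
  by (simp_all add: ccw_def algebra_simps)

lemma ccw_split: "ccw x y q + ccw y z q + ccw z x q = ccw x y z"
  by (simp add: ccw_def algebra_simps)

lemma ccw_affine:
  "ccw x y ((1 - t) *\<^sub>R p + t *\<^sub>R q) = (1 - t) * ccw x y p + t * ccw x y q"
  by (simp add: ccw_def algebra_simps)

lemma ccw_affine':
  "ccw x y (p + t *\<^sub>R (q - p)) = (1 - t) * ccw x y p + t * ccw x y q"
  by (simp add: ccw_def algebra_simps)

lemma continuous_ccw [continuous_intros]:
  assumes "continuous_on S f" "continuous_on S g" "continuous_on S h"
  shows "continuous_on S (\<lambda>t. ccw (f t) (g t) (h t))"
  unfolding ccw_def using assms by (intro continuous_intros)

lemma tendsto_ccw [tendsto_intros]:
  assumes "(f \<longlongrightarrow> x) F" "(g \<longlongrightarrow> y) F" "(h \<longlongrightarrow> z) F"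
  shows "((\<lambda>t. ccw (f t) (g t) (h t)) \<longlongrightarrow> ccw x y z) F"
  unfolding ccw_def using assms by (intro tendsto_intros)

lemma eventually_ccw_pos: "ccw x y q > 0 \<Longrightarrow> \<forall>\<^sub>F z in nhds q. ccw x y z > 0"
  by (rule order_tendstoD(1)[of _ "ccw x y q"]) (intro tendsto_intros filterlim_ident)

text \<open>An intersection of half-planes, so the order of the corners matters: by
  \<open>ccw_split\<close> it is empty for clockwise or collinear corners. Inner faces and the outer
  face therefore need opposite corner orders.\<close>

definition open_triangle :: "complex \<Rightarrow> complex \<Rightarrow> complex \<Rightarrow> complex set" where
  "open_triangle x y z = {q. ccw x y q > 0 \<and> ccw y z q > 0 \<and> ccw z x q > 0}"

definition closed_triangle :: "complex \<Rightarrow> complex \<Rightarrow> complex \<Rightarrow> complex set" where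
  "closed_triangle x y z = {q. ccw x y q \<ge> 0 \<and> ccw y z q \<ge> 0 \<and> ccw z x q \<ge> 0}"

lemma open_triangle_rotate: "open_triangle x y z = open_triangle y z x"
  by (auto simp: open_triangle_def)

lemma closed_triangle_rotate: "closed_triangle x y z = closed_triangle y z x"
  by (auto simp: closed_triangle_def)

lemma open_open_triangle: "open (open_triangle x y z)"
  unfolding open_triangle_def
  by (intro open_Collect_conj open_Collect_less continuous_intros)

lemma closed_closed_triangle: "closed (closed_triangle x y z)"
  unfolding closed_triangle_def
  by (intro closed_Collect_conj closed_Collect_le continuous_intros)

lemma open_triangle_subset: "open_triangle x y z \<subseteq> closed_triangle x y z"
  by (auto simp: open_triangle_def closed_triangle_def)

lemma convex_closed_triangle: "convex (closed_triangle x y z)"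
  unfolding convex_alt closed_triangle_def by (simp add: ccw_affine)

lemma open_triangle_nondegenerate: "q \<in> open_triangle x y z \<Longrightarrow> ccw x y z > 0"
  using ccw_split[of x y q z] by (simp add: open_triangle_def)

lemma vertex_in_closed_triangle:
  assumes "ccw x y z \<ge> 0"
  shows "x \<in> closed_triangle x y z" "y \<in> closed_triangle x y z" "z \<in> closed_triangle x y z"
  using assms ccw_rotate[of x y z] ccw_rotate[of y z x] by (auto simp: closed_triangle_def)

lemma closed_segment_subset_closed_triangle:
  assumes "ccw x y z \<ge> 0"
  shows "closed_segment x y \<subseteq> closed_triangle x y z"
  by (intro closed_segment_subset convex_closed_triangle vertex_in_closed_triangle assms)

lemma centroid_in_open_triangle:
  assumes "ccw x y z > 0"
  shows "(x + y + z) /\<^sub>R 3 \<in> open_triangle x y z"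
proof -
  have "ccw x y ((x + y + z) /\<^sub>R 3) = ccw x y z / 3" for x y z
    by (simp add: ccw_def field_simps)
  from this[of x y z] this[of y z x] this[of z x y] show ?thesis
    using assms ccw_rotate[of x y z] ccw_rotate[of y z x]
    by (simp add: open_triangle_def add_ac)
qed

text \<open>Sliding \<open>q\<close> towards the centroid enters the open triangle at once: the
  three areas are affine along the way, nonnegative at \<open>q\<close> and positive at the
  centroid.\<close>

lemma closed_triangle_limit:
  assumes "ccw x y z > 0" "q \<in> closed_triangle x y z" "eventually P (nhds q)"
  shows "\<exists>q'\<in>open_triangle x y z. P q'"
proof -
  define c where "c = (x + y + z) /\<^sub>R 3"
  have c: "c \<in> open_triangle x y z"
    unfolding c_def by (rule centroid_in_open_triangle) fact
  have "((\<lambda>t. q + t *\<^sub>R (c - q)) \<longlongrightarrow> q + 0 *\<^sub>R (c - q)) (at_right 0)"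
    by (intro tendsto_intros)
  then have "filterlim (\<lambda>t. q + t *\<^sub>R (c - q)) (nhds q) (at_right 0)" by simp
  with assms(3) have "\<forall>\<^sub>F t in at_right 0. P (q + t *\<^sub>R (c - q))"
    by (simp add: filterlim_iff)
  moreover have "\<forall>\<^sub>F t in at_right (0::real). 0 < t \<and> t < 1"
    by (simp add: eventually_at_right_less eventually_conj_iff eventually_at_right_field)
       (meson zero_less_one)
  ultimately have "\<forall>\<^sub>F t in at_right 0. P (q + t *\<^sub>R (c - q)) \<and> 0 < t \<and> t < 1"
    by (rule eventually_conj)
  then obtain t where t: "P (q + t *\<^sub>R (c - q))" "0 < t" "t < 1"
    using eventually_happens[of _ "at_right (0::real)"] by force
  have "q + t *\<^sub>R (c - q) \<in> open_triangle x y z"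
    using c assms(2) t by (auto simp: open_triangle_def closed_triangle_def ccw_affine' intro!: add_nonneg_pos)
  with t show ?thesis by blast
qed

lemma interior_line: "x \<noteq> y \<Longrightarrow> interior {q. ccw x y q = 0} = {}"
proof -
  assume "x \<noteq> y"
  have "{q. ccw x y q = 0} = {q. (\<i> * (y - x)) \<bullet> q = (\<i> * (y - x)) \<bullet> x}"
    by (auto simp: ccw_def inner_complex_def algebra_simps)
  with \<open>x \<noteq> y\<close> show ?thesis by simp
qed

lemma interior_finite_Union_closed:
  fixes F :: "'a::topological_space set set"
  assumes "finite F" "\<And>A. A \<in> F \<Longrightarrow> closed A \<and> interior A = {}"
  shows "interior (\<Union>F) = {}"
  using assms
  by (induction F rule: finite_induct) (auto simp: interior_closed_Un_empty_interior)

section \<open>The winding number of a triangle around a point\<close>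

lemma Im_quotient: "Im ((y - q) / (x - q)) = ccw x y q / (cmod (x - q))\<^sup>2"
  by (simp add: ccw_def Im_divide cmod_power2 algebra_simps)

lemma sgn_Im_quotient: "x \<noteq> q \<Longrightarrow> sgn (Im ((y - q) / (x - q))) = sgn (ccw x y q)"
  unfolding Im_quotient sgn_divide by simp

text \<open>The three quotients multiply to 1, so their arguments add up to a multiple of 2 pi. Each
  is strictly between -pi and pi because \<open>q\<close> is on no side line, which leaves the
  factors -1, 0 and 1. The factor -1 would make all three areas negative, although they add up to
  the positive \<open>ccw x y z\<close>.\<close>

lemma Arg_triangle_sum:
  assumes "ccw x y z > 0" "ccw x y q \<noteq> 0" "ccw y z q \<noteq> 0" "ccw z x q \<noteq> 0"
  shows "Arg ((y - q) / (x - q)) + Arg ((z - q) / (y - q)) + Arg ((x - q) / (z - q)) =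
    (if q \<in> open_triangle x y z then 2 * pi else 0)"
proof -
  define r1 r2 r3 where "r1 = (y - q) / (x - q)" and "r2 = (z - q) / (y - q)" and "r3 = (x - q) / (z - q)"
  have ne: "x \<noteq> q" "y \<noteq> q" "z \<noteq> q"
    using assms by auto
  have sgn: "sgn (Im r1) = sgn (ccw x y q)" "sgn (Im r2) = sgn (ccw y z q)" "sgn (Im r3) = sgn (ccw z x q)"
    unfolding r1_def r2_def r3_def using ne by (simp_all add: sgn_Im_quotient)
  have nz: "Im r1 \<noteq> 0" "Im r2 \<noteq> 0" "Im r3 \<noteq> 0"
    using sgn assms(2-4) by (metis sgn_0_0)+
  have pos: "0 < Arg r1 \<longleftrightarrow> 0 < ccw x y q" "0 < Arg r2 \<longleftrightarrow> 0 < ccw y z q" "0 < Arg r3 \<longleftrightarrow> 0 < ccw z x q"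
    using sgn nz by (simp_all add: Arg_pos_iff) (metis sgn_greater)+
  have neg: "Arg r1 < 0 \<longleftrightarrow> ccw x y q < 0" "Arg r2 < 0 \<longleftrightarrow> ccw y z q < 0" "Arg r3 < 0 \<longleftrightarrow> ccw z x q < 0"
    using sgn by (simp_all add: Arg_neg_iff) (metis sgn_less)+
  have bd: "\<bar>Arg r\<bar> < pi" if "Im r \<noteq> 0" for r
    using that mpi_less_Arg[of r] Arg_le_pi[of r] Arg_eq_pi[of r] by linarith
  define s where "s = Arg r1 + Arg r2 + Arg r3"
  have "cis s = sgn (r1 * r2 * r3)"
    using ne by (simp add: s_def sgn_mult cis_Arg sgn_zero_iff r1_def r2_def r3_def flip: cis_mult)
  also have "r1 * r2 * r3 = 1"
    using ne by (simp add: r1_def r2_def r3_def)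
  finally have "cos s = 1" by (simp add: complex_eq_iff)
  then obtain n :: int where n: "s = of_int n * (2 * pi)"
    by (auto simp: cos_one_2pi_int)
  have s_bd: "\<bar>s\<bar> < 3 * pi"
    using bd[OF nz(1)] bd[OF nz(2)] bd[OF nz(3)] by (auto simp: s_def)
  have "\<bar>of_int n * 2 * pi\<bar> < 3 * pi"
    using s_bd unfolding n by (simp only: mult.assoc)
  then have "\<bar>of_int n * 2\<bar> < (3::real)"
    using pi_gt_zero unfolding abs_mult[of _ pi] by (simp only: abs_of_pos mult_less_cancel_right_pos)
  then have "\<bar>n * 2\<bar> < 3"
    by linarith
  then have n_cases: "n = 0 \<or> n = 1 \<or> n = -1" by presburger
  have "n \<noteq> -1"
  proof
    assume "n = -1"
    with n have "Arg r1 + Arg r2 + Arg r3 = -2 * pi" by (simp add: s_def)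
    with bd[OF nz(1)] bd[OF nz(2)] bd[OF nz(3)] have "Arg r1 < 0" "Arg r2 < 0" "Arg r3 < 0" by linarith+
    with neg ccw_split[of x y q z] assms(1) show False by simp
  qed
  moreover have "n = 1 \<longleftrightarrow> q \<in> open_triangle x y z"
  proof
    assume "n = 1"
    with n have "Arg r1 + Arg r2 + Arg r3 = 2 * pi" by (simp add: s_def)
    with bd[OF nz(1)] bd[OF nz(2)] bd[OF nz(3)] have "Arg r1 > 0" "Arg r2 > 0" "Arg r3 > 0" by linarith+
    with pos show "q \<in> open_triangle x y z" by (simp add: open_triangle_def)
  next
    assume "q \<in> open_triangle x y z"
    with pos have "s > 0" by (simp add: open_triangle_def s_def)
    with n n_cases show "n = 1" by auto
  qed
  ultimately show ?thesis using n n_cases unfolding s_def r1_def r2_def r3_def by (auto split: if_splits)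
qed

subsection \<open>Combinatorics of plane triangulations\<close>

lemma orbit_card_period:
  assumes "x \<in> orbit f x"
  shows "(f ^^ card (orbit f x)) x = x"
proof -
  have "card (orbit f x) = funpow_dist1 f x x"
    using card_image[OF inj_on_funpow_dist1[OF assms]]
    unfolding orbit_conv_funpow_dist1[OF assms] by simp
  then show ?thesis using funpow_dist1_prop[OF assms] by simp
qed

text \<open>\<open>orbit f x\<close> starts at \<open>f x\<close>, so membership of \<open>x\<close>
  says that iteration returns. Extending \<open>f\<close> by the identity outside \<open>S\<close>
  gives a permutation with the same orbit.\<close>

lemma bij_betw_self_in_orbit:
  assumes "bij_betw f S S" "finite S" "x \<in> S"
  shows "x \<in> orbit f x"
proof -
  define g where "g = (\<lambda>y. if y \<in> S then f y else y)"
  have "g permutes S"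
    using assms(1) by (auto intro!: bij_imp_permutes simp: g_def bij_betw_def inj_on_def image_def)
  with assms(2) have "permutation g" by (auto simp: permutation_permutes)
  then have "x \<in> orbit g x" by (rule permutation_self_in_orbit)
  moreover have "orbit f x = orbit g x"
    using assms(1) by (intro orbit_cong0[OF assms(3)]) (auto simp: g_def bij_betw_def)
  ultimately show ?thesis by simp
qed

locale triangulation =
  fixes G :: "'v embedded_graph"
  assumes triangulated: "triangulated_planar_graph G"
begin

abbreviation V :: "'v set" where "V \<equiv> vertices G"
abbreviation D :: "('v \<times> 'v) set" where "D \<equiv> darts G"
text \<open>\<open>face_step\<close> sends \<open>(u, v)\<close> to \<open>(v, rot G v u)\<close>,
  so this is the third corner of the face to the right of \<open>(u, v)\<close>.\<close>

abbreviation third :: "'v \<Rightarrow> 'v \<Rightarrow> 'v" where "third u v \<equiv> rot G v u"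

lemma plane_embedding: "plane_embedding G"
  and face_card: "F \<in> faces G \<Longrightarrow> card F = 3"
  using triangulated by (auto simp: triangulated_planar_graph_def)

lemma pair_graph: "pair_graph (graph G)"
  using plane_embedding by (simp add: plane_embedding_def)

lemma finite_V: "finite V" and finite_D: "finite D"
proof -
  interpret pair_graph "graph G" by (rule pair_graph)
  show "finite V" "finite D" using pair_finite_verts pair_finite_arcs by auto
qed

lemma dart_sym: "(u, v) \<in> D \<Longrightarrow> (v, u) \<in> D"
proof -
  interpret pair_graph "graph G" by (rule pair_graph)
  show "(u, v) \<in> D \<Longrightarrow> (v, u) \<in> D"
    using pair_sym_arcs by (auto simp: symmetric_def sym_def)
qed

lemma dart_irrefl: "(u, v) \<in> D \<Longrightarrow> u \<noteq> v"
proof -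
  interpret pair_graph "graph G" by (rule pair_graph)
  show "(u, v) \<in> D \<Longrightarrow> u \<noteq> v" using pair_no_loops by fastforce
qed

lemma dart_vertices: assumes "(u, v) \<in> D" shows "u \<in> V" "v \<in> V"
proof -
  interpret pair_graph "graph G" by (rule pair_graph)
  show "u \<in> V" "v \<in> V" using assms by (auto dest: in_arcsD1 in_arcsD2)
qed

lemma neighbours_iff: "u \<in> neighbours G v \<longleftrightarrow> (u, v) \<in> D"
  by (auto simp: neighbours_def intro: dart_sym)

lemma finite_neighbours: "finite (neighbours G v)"
  by (rule finite_subset[OF _ finite_V]) (auto simp: neighbours_iff dest: dart_vertices)

lemma rot_cyclic: "v \<in> V \<Longrightarrow> cyclic_on (rot G v) (neighbours G v)"
  using plane_embedding by (simp add: plane_embedding_def)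

lemma rot_bij: assumes "v \<in> V" shows "bij_betw (rot G v) (neighbours G v) (neighbours G v)"
proof -
  have "rot G v ` neighbours G v = neighbours G v"
  proof
    show "rot G v ` neighbours G v \<subseteq> neighbours G v"
      using rot_cyclic[OF assms] cyclic_on_inI by fastforce
    show "neighbours G v \<subseteq> rot G v ` neighbours G v"
    proof
      fix x assume x: "x \<in> neighbours G v"
      then have S: "neighbours G v = orbit (rot G v) x"
        using rot_cyclic[OF assms] by (auto simp: cyclic_on_alldef)
      with x have "x \<in> orbit (rot G v) x" by simp
      then show "x \<in> rot G v ` neighbours G v"
      proof cases
        case base
        with x show ?thesis by blast
      next
        case (step y)
        with S show ?thesis by blast
      qed
    qed
  qed
  then show ?thesis
    using finite_neighbours by (simp add: bij_betw_def eq_card_imp_inj_on)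
qed

lemma neighbour_exists: "v \<in> V \<Longrightarrow> \<exists>u. (u, v) \<in> D"
  using rot_cyclic by (force simp: cyclic_on_alldef neighbours_iff)

text \<open>The rotation at \<open>v\<close> is a single cycle, so a property inherited by the next
  neighbour reaches all of them. Read contrapositively, it finds two consecutive neighbours between
  which a property is lost.\<close>

lemma rot_induct:
  assumes "(u, v) \<in> D" "P u" "\<And>x. (x, v) \<in> D \<Longrightarrow> P x \<Longrightarrow> P (rot G v x)" "(y, v) \<in> D"
  shows "P y"
proof -
  have cyc: "neighbours G v = orbit (rot G v) u"
    using rot_cyclic[of v] assms(1) dart_vertices by (auto simp: cyclic_on_alldef neighbours_iff)
  then have "y \<in> orbit (rot G v) u"
    using assms(4) by (simp add: neighbours_iff[symmetric])
  then show ?thesis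
  proof induction
    case base
    show ?case by (rule assms(3)) fact+
  next
    case (step y)
    then show ?case using cyc by (intro assms(3)) (auto simp: neighbours_iff[symmetric])
  qed
qed

lemma face_step_bij: "bij_betw (face_step G) D D"
proof -
  have "inj_on (face_step G) D"
  proof (rule inj_onI, clarify)
    fix u v x y assume *: "(u, v) \<in> D" "(x, y) \<in> D" "face_step G (u, v) = face_step G (x, y)"
    then have "v = y" "rot G v u = rot G v x" by (auto simp: face_step_def)
    then show "u = x \<and> v = y"
      using * bij_betw_imp_inj_on[OF rot_bij[of v]] dart_vertices
      by (auto simp: inj_on_def neighbours_iff)
  qed
  moreover have "face_step G ` D \<subseteq> D"
  proof (intro image_subsetI, unfold split_paired_all)
    fix u v assume uv: "(u, v) \<in> D"
    then have "rot G v u \<in> neighbours G v"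
      using bij_betw_apply[OF rot_bij, of v u] dart_vertices by (simp add: neighbours_iff)
    then show "face_step G (u, v) \<in> D" by (simp add: face_step_def neighbours_def)
  qed
  ultimately show ?thesis
    using finite_D by (simp add: bij_betw_def endo_inj_surj)
qed

lemma self_in_face: "d \<in> D \<Longrightarrow> d \<in> orbit (face_step G) d"
  by (rule bij_betw_self_in_orbit[OF face_step_bij finite_D])

lemma face_step_period:
  assumes "d \<in> D" shows "face_step G (face_step G (face_step G d)) = d"
proof -
  have "card (orbit (face_step G) d) = 3"
    using assms by (intro face_card) (simp add: faces_def)
  with orbit_card_period[OF self_in_face[OF assms]] show ?thesis
    by (simp add: numeral_3_eq_3)
qed

lemma face_triangle:
  assumes "(u, v) \<in> D"
  shows "(v, third u v) \<in> D" "(third u v, u) \<in> D"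
    "third v (third u v) = u" "third (third u v) u = v"
    "u \<noteq> v" "third u v \<noteq> u" "third u v \<noteq> v"
proof -
  have "face_step G d \<in> D" if "d \<in> D" for d
    using that by (rule bij_betw_apply[OF face_step_bij])
  then have 1: "face_step G (u, v) \<in> D" "face_step G (face_step G (u, v)) \<in> D"
    using assms by auto
  from face_step_period[OF assms] 1
  show "(v, third u v) \<in> D" "(third u v, u) \<in> D" "third v (third u v) = u" "third (third u v) u = v"
    by (auto simp: face_step_def)
  then show "u \<noteq> v" "third u v \<noteq> u" "third u v \<noteq> v"
    using assms dart_irrefl by metis+
qed

lemma face_orbit:
  assumes "(u, v) \<in> D"
  shows "orbit (face_step G) (u, v) = {(u, v), (v, third u v), (third u v, u)}"
proof -
  have "orbit (face_step G) (u, v) = {((face_step G) ^^ m) (u, v) | m. m < 3}"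
    using face_step_period[OF assms] by (intro orbit_altdef_bounded) (auto simp: numeral_3_eq_3)
  also have "\<dots> = (\<lambda>m. ((face_step G) ^^ m) (u, v)) ` {..<3}" by auto
  also have "{..<3::nat} = {0, 1, 2}" by auto
  finally show ?thesis
    using face_triangle[OF assms] by (simp add: face_step_def numeral_2_eq_2)
qed

lemma outer_face_in_faces: "outer_face G \<in> faces G"
  using plane_embedding by (simp add: plane_embedding_def)

lemma outer_face_subset: "outer_face G \<subseteq> D"
proof -
  obtain u v where uv: "outer_face G = orbit (face_step G) (u, v)" "(u, v) \<in> D"
    using outer_face_in_faces by (auto simp: faces_def)
  show ?thesis unfolding uv(1) face_orbit[OF uv(2)] using face_triangle[OF uv(2)] uv(2) by auto
qed

lemma face_eq_orbit:
  assumes "F \<in> faces G" "d \<in> F"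
  shows "F = orbit (face_step G) d" "d \<in> D"
proof -
  obtain u v where uv: "F = orbit (face_step G) (u, v)" "(u, v) \<in> D"
    using assms by (auto simp: faces_def)
  note t = face_triangle[OF uv(2)]
  have "d = (u, v) \<or> d = (v, third u v) \<or> d = (third u v, u)"
    using assms(2) unfolding uv(1) face_orbit[OF uv(2)] by simp
  then show "F = orbit (face_step G) d" "d \<in> D"
    unfolding uv(1) using uv(2) t(1-4) face_orbit[OF uv(2)] face_orbit[OF t(1)] face_orbit[OF t(2)]
    by (elim disjE; simp add: insert_commute)+
qed

lemma outer_face_eq:
  assumes "(u, v) \<in> outer_face G"
  shows "outer_face G = {(u, v), (v, third u v), (third u v, u)}"
  using face_eq_orbit[OF outer_face_in_faces assms] face_orbit by simp

lemma outer_face_nonempty: obtains u v where "(u, v) \<in> outer_face G"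
  using face_card[OF outer_face_in_faces] by (metis card.empty ex_in_conv surj_pair zero_neq_numeral)

lemma outer_face_step: "(u, v) \<in> outer_face G \<longleftrightarrow> (u, v) \<in> D \<and> (v, third u v) \<in> outer_face G"
proof
  assume "(u, v) \<in> outer_face G"
  then show "(u, v) \<in> D \<and> (v, third u v) \<in> outer_face G"
    using outer_face_eq outer_face_subset by blast
next
  assume *: "(u, v) \<in> D \<and> (v, third u v) \<in> outer_face G"
  then have "third v (third u v) = u" "third (third u v) u = v" using face_triangle by blast+
  with outer_face_eq[of v "third u v"] * show "(u, v) \<in> outer_face G" by simp
qed

lemma outer_face_not_reversed:
  assumes "(u, v) \<in> outer_face G" shows "(v, u) \<notin> outer_face G"
proof -
  have "(u, v) \<in> D" using assms outer_face_subset by blast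
  then show ?thesis using face_triangle[of u v] unfolding outer_face_eq[OF assms] by auto
qed

lemma inner_dart_exists:
  assumes "v \<in> V" obtains u where "(u, v) \<in> D" "(u, v) \<notin> outer_face G"
proof -
  obtain u where u: "(u, v) \<in> D" using neighbour_exists[OF assms] by blast
  show thesis
  proof (cases "(u, v) \<in> outer_face G")
    case True
    \<comment> \<open>The reverse of the next outer dart serves, since the outer face contains no
      dart together with its reverse.\<close>
    have t: "(third u v, v) \<in> D" using face_triangle(1)[OF u] by (rule dart_sym)
    have "(third u v, v) \<notin> outer_face G"
      using True outer_face_step[of u v] outer_face_not_reversed by blast
    with t that show thesis by blast
  qed (use u that in blast)
qed

lemma connected_induct:
  assumes "u \<in> V" "P u" "\<And>x y. (x, y) \<in> D \<Longrightarrow> P x \<Longrightarrow> P y" "v \<in> V"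
  shows "P v"
proof -
  interpret pair_graph "graph G" by (rule pair_graph)
  have "connected (with_proj (graph G))"
    using plane_embedding by (simp add: plane_embedding_def)
  then have "strongly_connected (with_proj (graph G))"
    by (intro symmetric_connected_imp_strongly_connected pair_sym_arcs)
  then have "u \<rightarrow>\<^sup>*\<^bsub>with_proj (graph G)\<^esub> v"
    using assms(1,4) by (auto simp: strongly_connected_def)
  then show ?thesis
  proof (induction rule: reachable_induct)
    case (step x y)
    then have "(x, y) \<in> D" by simp
    with step.IH assms(3) show ?case by blast
  qed (rule assms(2))
qed

text \<open>Faces partition the darts into triples and edges pair them up; Euler's formula then ties
  the number of darts to the number of vertices. Applied to \<open>G\<close> and to a contraction of
  it, this counts common neighbours.\<close>

lemma card_darts: "int (card D) = 6 * int (card V) - 12"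
proof -
  have D_eq: "\<Union>(faces G) = D"
  proof
    show "\<Union>(faces G) \<subseteq> D" using face_eq_orbit(2) by blast
    show "D \<subseteq> \<Union>(faces G)" using self_in_face by (auto simp: faces_def)
  qed
  have "3 * card (faces G) = card (\<Union>(faces G))"
  proof (rule card_partition)
    show "finite (faces G)" unfolding faces_def using finite_D by simp
    show "finite (\<Union>(faces G))" using D_eq finite_D by simp
    show "\<And>c. c \<in> faces G \<Longrightarrow> card c = 3" by (rule face_card)
    show "c1 \<inter> c2 = {}" if "c1 \<in> faces G" "c2 \<in> faces G" "c1 \<noteq> c2" for c1 c2
      using that face_eq_orbit(1) by (metis disjoint_iff)
  qed
  then have 1: "3 * card (faces G) = card D" by (simp add: D_eq)
  have "2 * card ((\<lambda>(u, v). {(u, v), (v, u)}) ` D) = card (\<Union>((\<lambda>(u, v). {(u, v), (v, u)}) ` D))"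
  proof (rule card_partition)
    show "finite ((\<lambda>(u, v). {(u, v), (v, u)}) ` D)" using finite_D by blast
    then show "finite (\<Union>((\<lambda>(u, v). {(u, v), (v, u)}) ` D))" by (rule finite_Union) auto
    show "card c = 2" if "c \<in> (\<lambda>(u, v). {(u, v), (v, u)}) ` D" for c
      using that dart_irrefl by (auto simp: card_insert_if)
  qed auto
  also have "\<Union>((\<lambda>(u, v). {(u, v), (v, u)}) ` D) = D" using dart_sym by auto
  finally have "even (card D)" by (rule dvdI[OF sym])
  moreover have "int (card V) - int (card D div 2) + int (card (faces G)) = 2"
    using plane_embedding by (simp add: plane_embedding_def)
  ultimately show ?thesis using 1 by (auto elim!: evenE)
qed

end

subsection \<open>Faces of a planar drawing are correctly oriented\<close>

lemma ccw_barycentric: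
  "of_real (ccw a b c) * z = of_real (ccw b c z) * a + of_real (ccw c a z) * b + of_real (ccw a b z) * c"
  by (simp add: complex_eq_iff ccw_def) (simp add: algebra_simps)

lemma closed_triangle_subset_hull:
  assumes "ccw a b c > 0" "z \<in> closed_triangle a b c"
  shows "z \<in> convex hull {a, b, c}"
proof -
  let ?n = "ccw a b c"
  have "z = (ccw b c z / ?n) *\<^sub>R a + (ccw c a z / ?n) *\<^sub>R b + (ccw a b z / ?n) *\<^sub>R c"
    using ccw_barycentric[of a b c z] assms(1) by (simp add: scaleR_conv_of_real field_simps)
  moreover have "ccw b c z / ?n + ccw c a z / ?n + ccw a b z / ?n = 1"
    using ccw_split[of a b z c] assms(1) by (simp add: field_simps)
  ultimately show ?thesis
    using assms unfolding convex_hull_3 closed_triangle_def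
    by (smt (verit) divide_nonneg_pos mem_Collect_eq)
qed

lemma closed_triangle_edge:
  assumes "ccw a b c > 0" "z \<in> closed_triangle a b c" "ccw a b z = 0"
  shows "z \<in> closed_segment a b"
proof -
  let ?n = "ccw a b c"
  have "z = (ccw b c z / ?n) *\<^sub>R a + (ccw c a z / ?n) *\<^sub>R b"
    using ccw_barycentric[of a b c z] assms(1,3) by (simp add: scaleR_conv_of_real field_simps)
  moreover have "ccw b c z / ?n = 1 - ccw c a z / ?n"
    using ccw_split[of a b z c] assms(1,3) by (simp add: field_simps)
  moreover from this have "ccw c a z / ?n \<le> 1"
    using assms by (simp add: closed_triangle_def field_simps) 
  ultimately show ?thesis
    using assms by (auto simp: closed_segment_def closed_triangle_def intro!: exI[of _ "ccw c a z / ?n"])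
qed

lemma closed_triangle_boundary:
  assumes "ccw a b c > 0" "z \<in> closed_triangle a b c" "z \<notin> open_triangle a b c"
  shows "z \<in> closed_segment a b \<or> z \<in> closed_segment b c \<or> z \<in> closed_segment c a"
  using assms closed_triangle_edge[of a b c z] closed_triangle_edge[of b c a z] closed_triangle_edge[of c a b z]
    ccw_rotate[of a b c] ccw_rotate[of b c a]
  by (auto simp: closed_triangle_rotate[of a b c] closed_triangle_rotate[of b c a])
     (auto simp: closed_triangle_def open_triangle_def)

lemma segment_leaves_closed_triangle:
  assumes "ccw a b c > 0" "x \<in> closed_triangle a b c" "y \<notin> closed_triangle a b c"
  obtains z where "z \<in> closed_segment x y" "z \<in> closed_triangle a b c"
    "z \<in> closed_segment a b \<or> z \<in> closed_segment b c \<or> z \<in> closed_segment c a"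
proof -
  have "closed_segment x y \<inter> frontier (closed_triangle a b c) \<noteq> {}"
    using assms by (intro connected_Int_frontier) auto
  then obtain z where z: "z \<in> closed_segment x y" "z \<in> frontier (closed_triangle a b c)" by blast
  then have "z \<in> closed_triangle a b c"
    using closed_closed_triangle frontier_subset_eq by blast
  moreover have "z \<notin> open_triangle a b c"
    using z(2) interior_maximal[OF open_triangle_subset open_open_triangle] by (auto simp: frontier_def)
  ultimately show thesis
    using z(1) closed_triangle_boundary[OF assms(1)] that by blast
qed

text \<open>A point in the wedge at \<open>a\<close> but outside the triangle must be beyond the
  side \<open>b c\<close>, so the segment from \<open>a\<close> to it crosses that side.\<close>

lemma segment_from_corner:
  assumes "ccw a b c > 0" "y \<notin> closed_triangle a b c" "ccw a b y \<ge> 0" "ccw c a y \<ge> 0"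
  obtains z where "z \<in> closed_segment a y" "z \<in> closed_segment b c"
proof -
  have neg: "ccw b c y < 0"
    using assms by (auto simp: closed_triangle_def)
  have pos: "ccw b c a > 0"
    using assms(1) ccw_rotate[of a b c] by simp
  \<comment> \<open>The zero of \<open>ccw b c\<close>, which is affine along the segment, positive
    at \<open>a\<close> and negative at \<open>y\<close>.\<close>
  define t where "t = ccw b c a / (ccw b c a - ccw b c y)"
  define z where "z = a + t *\<^sub>R (y - a)"
  have t: "0 \<le> t" "t \<le> 1"
    using neg pos by (auto simp: t_def divide_simps)
  have "ccw b c z = (1 - t) * ccw b c a + t * ccw b c y"
    unfolding z_def by (rule ccw_affine')
  then have "ccw b c z = 0"
    using neg pos by (simp add: t_def field_simps)
  moreover have "ccw a b z \<ge> 0" "ccw c a z \<ge> 0"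
    using t assms by (simp_all add: z_def ccw_affine')
  ultimately have "z \<in> closed_segment b c"
    using assms(1) ccw_rotate[of a b c]
    by (intro closed_triangle_edge[of b c a]) (auto simp: closed_triangle_def)
  moreover have "z \<in> closed_segment a y"
    using t by (auto simp: z_def closed_segment_def algebra_simps intro!: exI[of _ t])
  ultimately show thesis using that by blast
qed

lemma open_triangle_inside:
  assumes "q \<in> open_triangle a b c"
  shows "q \<in> inside (closed_segment a b \<union> closed_segment b c \<union> closed_segment c a)"
proof -
  have "ccw a b c > 0" using open_triangle_nondegenerate assms by blast
  then have "open_triangle a b c \<subseteq> convex hull {a, b, c}"
    using closed_triangle_subset_hull open_triangle_subset by blast
  then have "open_triangle a b c \<subseteq> interior (convex hull {a, b, c})"
    using open_open_triangle by (rule interior_maximal)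
  then show ?thesis
    using assms by (auto simp: inside_of_triangle)
qed

lemma collinear_cases:
  assumes "ccw a b c = 0" "a \<noteq> b"
  shows "c \<in> closed_segment a b \<or> a \<in> closed_segment b c \<or> b \<in> closed_segment c a"
proof -
  have "ccw b c a = 0"
    using assms(1) ccw_rotate[of a b c] by simp
  then have "Im ((c - a) / (b - a)) = 0" by (simp add: Im_quotient)
  then obtain t where "(c - a) / (b - a) = of_real t"
    by (metis complex_is_Real_iff Reals_cases)
  then have c: "c = a + t *\<^sub>R (b - a)"
    using assms(2) by (simp add: field_simps scaleR_conv_of_real)
  consider "0 \<le> t \<and> t \<le> 1" | "t < 0" | "t > 1" by linarith
  then show ?thesis
  proof cases
    case 1
    then have "c \<in> closed_segment a b"
      unfolding closed_segment_def c by (auto simp: algebra_simps intro!: exI[of _ t])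
    then show ?thesis by blast
  next
    case 2
    have "(1 - s) *\<^sub>R b + s *\<^sub>R c = b + (s * (1 - t)) *\<^sub>R (a - b)" for s
      by (simp add: c algebra_simps)
    from this[of "1 / (1 - t)"] have "a = (1 - 1 / (1 - t)) *\<^sub>R b + (1 / (1 - t)) *\<^sub>R c"
      using 2 by simp
    then have "a \<in> closed_segment b c"
      unfolding in_segment using 2 by (intro exI[of _ "1 / (1 - t)"] conjI) auto
    then show ?thesis by blast
  next
    case 3
    have "b = (1 - (1 - 1 / t)) *\<^sub>R c + (1 - 1 / t) *\<^sub>R a"
      using 3 by (simp add: c complex_eq_iff field_simps)
    then have "b \<in> closed_segment c a"
      unfolding in_segment using 3 by (intro exI[of _ "1 - 1 / t"] conjI) auto
    then show ?thesis by blast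
  qed
qed

lemma Im_cnj_mult_Arg2pi:
  "Im (cnj z * z') = cmod z * cmod z' * sin (Arg2pi z' - Arg2pi z)"
proof -
  note polar = cos_Arg2pi[symmetric] sin_Arg2pi[symmetric]
  have "Im (cnj z * z') = Re z * Im z' - Im z * Re z'" by simp
  also have "\<dots> = cmod z * cmod z' * sin (Arg2pi z' - Arg2pi z)"
    unfolding polar[of z] polar[of z'] sin_diff by (simp only: algebra_simps)
  finally show ?thesis .
qed

text \<open>Division by \<open>d - c\<close> is a similarity of the plane and scales signed areas by
  the square of its factor. This permits measuring angles from the direction of \<open>d\<close>, as
  \<open>ccw_angle\<close> does.\<close>

lemma ccw_quotient:
  "Im (cnj ((x - c) / (d - c)) * ((y - c) / (d - c))) = ccw c x y / (cmod (d - c))\<^sup>2"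
proof -
  have *: "Im (cnj (p / e) * (q / e)) = Im (cnj p * q) / (cmod e)\<^sup>2" for p q e
  proof -
    have "cnj (p / e) * (q / e) = (cnj p * q) / of_real ((cmod e)\<^sup>2)"
      using complex_norm_square[of e] by (simp add: mult.commute)
    then show ?thesis by (simp only: Im_divide_of_real)
  qed
  show ?thesis unfolding * ccw_def ..
qed

text \<open>Both angles measured from \<open>x\<close> lie between pi and 2 pi, so \<open>z\<close>
  is in the wedge swept counterclockwise from \<open>y\<close> to \<open>x\<close>, which is
  narrower than a half-plane.\<close>

lemma ccw_angle_le_reflex:
  assumes "ccw c x y < 0" "ccw_angle c x y \<le> ccw_angle c x z"
  shows "ccw c x z < 0" "ccw c y z \<ge> 0"
proof -
  have ne: "x \<noteq> c" using assms by auto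
  define a b where "a = (y - c) / (x - c)" and "b = (z - c) / (x - c)"
  have le: "Arg2pi a \<le> Arg2pi b" using assms(2) by (simp add: ccw_angle_def a_def b_def)
  have Im: "Im a = ccw c x y / (cmod (x - c))\<^sup>2" "Im b = ccw c x z / (cmod (x - c))\<^sup>2"
    using ccw_rotate[of c x] by (simp_all add: a_def b_def Im_quotient)
  then have "Im a < 0" using assms(1) ne by (simp add: divide_neg_pos)
  then have a: "Arg2pi a > pi" using Arg2pi_le_pi[of a] by simp
  with le have "Im b < 0" using Arg2pi_le_pi[of b] by simp
  then show "ccw c x z < 0" using ne Im by (simp add: divide_simps split: if_splits)
  have "Im (cnj a * b) \<ge> 0"
    unfolding Im_cnj_mult_Arg2pi using le a Arg2pi[of b] by (intro mult_nonneg_nonneg sin_ge_zero) auto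
  then show "ccw c y z \<ge> 0"
    using ne unfolding a_def b_def ccw_quotient by (simp add: divide_simps split: if_splits)
qed

lemma ccw_right_of_midpoint:
  assumes "u \<noteq> v" "0 < e"
  shows "ccw v u (midpoint u v - of_real e * \<i> * (v - u)) > 0"
proof -
  have "ccw v u (midpoint u v - of_real e * \<i> * (v - u)) = e * ((Re v - Re u)\<^sup>2 + (Im v - Im u)\<^sup>2)"
    unfolding power2_eq_square by (simp add: midpoint_def ccw_def field_simps)
  moreover have "(Re v - Re u)\<^sup>2 + (Im v - Im u)\<^sup>2 > 0"
    using assms(1) by (auto simp: sum_power2_gt_zero_iff complex_eq_iff)
  ultimately show ?thesis using assms(2) by simp
qed

lemma right_of_midpoint:
  assumes "ccw v u w > 0"
  shows "\<forall>\<^sub>F e in at_right (0::real). midpoint u v - of_real e * \<i> * (v - u) \<in> open_triangle v u w"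
proof -
  let ?q = "\<lambda>e::real. midpoint u v - of_real e * \<i> * (v - u)"
  have lim: "(?q \<longlongrightarrow> midpoint u v - of_real 0 * \<i> * (v - u)) (at_right 0)"
    by (intro tendsto_intros)
  have mid: "ccw a b (midpoint u v) = (ccw a b u + ccw a b v) / 2" for a b
    by (simp add: midpoint_def ccw_def field_simps)
  have "ccw u w (midpoint u v) > 0" "ccw w v (midpoint u v) > 0"
    using assms ccw_rotate[of v u w] ccw_rotate[of u w v] by (simp_all add: mid)
  then have "\<forall>\<^sub>F e in at_right 0. ccw u w (?q e) > 0" "\<forall>\<^sub>F e in at_right 0. ccw w v (?q e) > 0"
    using lim by (auto intro!: order_tendstoD(1)[OF tendsto_ccw[OF tendsto_const tendsto_const lim]])
  moreover have "u \<noteq> v" using assms by auto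
  then have "\<forall>\<^sub>F e in at_right (0::real). ccw v u (?q e) > 0"
    using ccw_right_of_midpoint by (auto simp: eventually_at_right_field intro!: exI[of _ 1])
  ultimately show ?thesis
    unfolding open_triangle_def by eventually_elim simp
qed

text \<open>A dart has its face on the right, which makes \<open>v\<close>, \<open>u\<close>,
  \<open>rot G v u\<close> counterclockwise for an inner face. The unbounded face is to the right of
  the outer darts, so their triangle is on the left and the sign flips.\<close>

definition oriented :: "'v embedded_graph \<Rightarrow> 'v drawing \<Rightarrow> bool" where
  "oriented G \<Gamma> \<longleftrightarrow>
     (\<forall>(u, v)\<in>darts G.
        if (u, v) \<in> outer_face G then ccw (\<Gamma> v) (\<Gamma> u) (\<Gamma> (rot G v u)) < 0
        else ccw (\<Gamma> v) (\<Gamma> u) (\<Gamma> (rot G v u)) > 0)"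

context triangulation
begin

context
  fixes \<Gamma> :: "'v drawing"
  assumes planar: "planar_drawing G \<Gamma>"
begin

lemma drawing_inj: "u \<in> V \<Longrightarrow> v \<in> V \<Longrightarrow> \<Gamma> u = \<Gamma> v \<longleftrightarrow> u = v"
  using planar by (auto simp: planar_drawing_def straight_line_planar_def inj_on_def)

lemma edges_meet:
  assumes "(u, v) \<in> D" "(x, y) \<in> D" "{u, v} \<noteq> {x, y}"
    "z \<in> closed_segment (\<Gamma> u) (\<Gamma> v)" "z \<in> closed_segment (\<Gamma> x) (\<Gamma> y)"
  obtains i where "i \<in> {u, v}" "i \<in> {x, y}" "z = \<Gamma> i"
  using planar assms unfolding planar_drawing_def straight_line_planar_def by blast

lemma vertex_not_on_edge:
  assumes "(u, v) \<in> D" "x \<in> V" "\<Gamma> x \<in> closed_segment (\<Gamma> u) (\<Gamma> v)"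
  shows "x \<in> {u, v}"
proof (rule ccontr)
  assume x: "x \<notin> {u, v}"
  obtain y where y: "(x, y) \<in> D" using neighbour_exists[OF assms(2)] dart_sym by blast
  obtain i where "i \<in> {x, y}" "i \<in> {u, v}" "\<Gamma> x = \<Gamma> i"
    using edges_meet[OF y assms(1)] x assms(3) by (metis ends_in_segment(1) insertI1)
  then show False using x drawing_inj dart_vertices assms by blast
qed

lemma triangle_nondegenerate:
  assumes "(u, v) \<in> D"
  shows "ccw (\<Gamma> v) (\<Gamma> u) (\<Gamma> (third u v)) \<noteq> 0"
proof
  note t = face_triangle[OF assms]
  note d = dart_vertices[OF assms] dart_vertices[OF t(1)]
  assume "ccw (\<Gamma> v) (\<Gamma> u) (\<Gamma> (third u v)) = 0"
  moreover have "\<Gamma> v \<noteq> \<Gamma> u" using t d by (simp add: drawing_inj)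
  ultimately have "\<Gamma> (third u v) \<in> closed_segment (\<Gamma> v) (\<Gamma> u) \<or> \<Gamma> v \<in> closed_segment (\<Gamma> u) (\<Gamma> (third u v)) \<or>
      \<Gamma> u \<in> closed_segment (\<Gamma> (third u v)) (\<Gamma> v)"
    by (rule collinear_cases)
  then show False
    using vertex_not_on_edge[OF dart_sym[OF assms] d(4)]
      vertex_not_on_edge[OF dart_sym[OF t(2)] d(2)] vertex_not_on_edge[OF dart_sym[OF t(1)] d(1)]
      t(5-7) by auto
qed

lemma outside_disjoint_triangle:
  assumes "(u, v) \<in> D" "ccw (\<Gamma> v) (\<Gamma> u) (\<Gamma> (third u v)) > 0 \<or> ccw (\<Gamma> u) (\<Gamma> v) (\<Gamma> (third u v)) > 0"
    "q \<in> open_triangle (\<Gamma> u) (\<Gamma> v) (\<Gamma> (third u v)) \<union> open_triangle (\<Gamma> v) (\<Gamma> u) (\<Gamma> (third u v))"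
  shows "q \<notin> outside (skeleton G \<Gamma>)"
proof -
  let ?E = "closed_segment (\<Gamma> u) (\<Gamma> v) \<union> closed_segment (\<Gamma> v) (\<Gamma> (third u v)) \<union>
    closed_segment (\<Gamma> (third u v)) (\<Gamma> u)"
  note t = face_triangle[OF assms(1)]
  have "?E \<subseteq> skeleton G \<Gamma>"
    using assms(1) t(1,2) by (auto simp: skeleton_def)
  then have "outside (skeleton G \<Gamma>) \<subseteq> outside ?E" by (rule outside_mono)
  moreover have "q \<in> inside ?E"
    using assms(3) open_triangle_inside[of q "\<Gamma> u" "\<Gamma> v" "\<Gamma> (third u v)"]
      open_triangle_inside[of q "\<Gamma> v" "\<Gamma> u" "\<Gamma> (third u v)"]
    by (auto simp: closed_segment_commute Un_ac)
  ultimately show ?thesis using inside_Int_outside by blast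
qed

text \<open>Otherwise the points just to the right of the midpoint, which belong to the unbounded
  region, would be enclosed by the three edges of the triangle.\<close>

lemma outer_dart_negative:
  assumes "(u, v) \<in> outer_face G"
  shows "ccw (\<Gamma> v) (\<Gamma> u) (\<Gamma> (third u v)) < 0"
proof (rule ccontr)
  have uv: "(u, v) \<in> D" using assms outer_face_subset by blast
  assume "\<not> ?thesis"
  with triangle_nondegenerate[OF uv] have pos: "ccw (\<Gamma> v) (\<Gamma> u) (\<Gamma> (third u v)) > 0" by simp
  let ?q = "\<lambda>e::real. midpoint (\<Gamma> u) (\<Gamma> v) - of_real e * \<i> * (\<Gamma> v - \<Gamma> u)"
  have "\<forall>\<^sub>F e in at_right 0. ?q e \<in> outside (skeleton G \<Gamma>)"
    using planar assms unfolding planar_drawing_def realizes_outer_face_def by blast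
  with right_of_midpoint[OF pos] have "\<forall>\<^sub>F e::real in at_right 0. False"
    by eventually_elim (use outside_disjoint_triangle[OF uv] pos in blast)
  then show False by simp
qed

text \<open>If an inner face is drawn clockwise, its angles as prescribed by the rotation are reflex,
  so that all other edges at its corners start inside the triangle.\<close>

lemma reversed_face_corner:
  assumes "(u, v) \<in> D" "ccw (\<Gamma> u) (\<Gamma> v) (\<Gamma> (third u v)) > 0" "(v, y) \<in> D"
  shows "\<Gamma> y \<in> closed_triangle (\<Gamma> u) (\<Gamma> v) (\<Gamma> (third u v))"
proof (rule ccontr)
  let ?w = "third u v"
  note t = face_triangle[OF assms(1)]
  assume nin: "\<Gamma> y \<notin> closed_triangle (\<Gamma> u) (\<Gamma> v) (\<Gamma> ?w)"
  have yu: "y \<noteq> u" "y \<noteq> ?w"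
    using nin vertex_in_closed_triangle[of "\<Gamma> u" "\<Gamma> v" "\<Gamma> ?w"] assms(2) by auto
  have "ccw_angle (\<Gamma> v) (\<Gamma> u) (\<Gamma> ?w) \<le> ccw_angle (\<Gamma> v) (\<Gamma> u) (\<Gamma> y)"
    using planar yu assms(1,3) dart_vertices[OF assms(1)] dart_sym
    by (auto simp: planar_drawing_def realizes_rotation_def neighbours_iff)
  moreover have neg: "ccw (\<Gamma> v) (\<Gamma> u) (\<Gamma> ?w) < 0"
    using assms(2) by (simp add: ccw_swap[of "\<Gamma> v" "\<Gamma> u"])
  ultimately have "ccw (\<Gamma> v) (\<Gamma> u) (\<Gamma> y) < 0" "ccw (\<Gamma> v) (\<Gamma> ?w) (\<Gamma> y) \<ge> 0"
    using ccw_angle_le_reflex by blast+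
  then have "ccw (\<Gamma> v) (\<Gamma> ?w) (\<Gamma> y) \<ge> 0" "ccw (\<Gamma> u) (\<Gamma> v) (\<Gamma> y) \<ge> 0"
    by (simp_all add: ccw_swap[of "\<Gamma> v" "\<Gamma> u"])
  \<comment> \<open>The rotation condition has put \<open>y\<close> into the wedge at
    \<open>v\<close>; being outside the triangle, it would force the edge \<open>v y\<close> to
    cross the opposite side.\<close>
  then obtain z where z: "z \<in> closed_segment (\<Gamma> v) (\<Gamma> y)" "z \<in> closed_segment (\<Gamma> ?w) (\<Gamma> u)"
    using segment_from_corner[of "\<Gamma> v" "\<Gamma> ?w" "\<Gamma> u" "\<Gamma> y"] nin assms(2)
    by (auto simp: closed_triangle_rotate[of "\<Gamma> u" "\<Gamma> v"] ccw_rotate[of "\<Gamma> u" "\<Gamma> v" "\<Gamma> ?w"])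
  obtain i where "i \<in> {v, y}" "i \<in> {?w, u}"
    using edges_meet[OF assms(3) t(2) _ z] t(5,7) by blast
  with t(5,7) yu show False by auto
qed

text \<open>Containment spreads along edges. At a corner this is
  \<open>reversed_face_corner\<close>; an edge from any other vertex can leave the triangle only
  through a side, where planarity permits no contact except at a corner that is its far end.\<close>

lemma reversed_face_contains_all:
  assumes "(u, v) \<in> D" "ccw (\<Gamma> u) (\<Gamma> v) (\<Gamma> (third u v)) > 0" "s \<in> V"
  shows "\<Gamma> s \<in> closed_triangle (\<Gamma> u) (\<Gamma> v) (\<Gamma> (third u v))"
proof (rule connected_induct[of v "\<lambda>s. \<Gamma> s \<in> closed_triangle (\<Gamma> u) (\<Gamma> v) (\<Gamma> (third u v))"])
  let ?w = "third u v"
  note t = face_triangle[OF assms(1)]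
  show "v \<in> V" using assms(1) dart_vertices by blast
  show "\<Gamma> v \<in> closed_triangle (\<Gamma> u) (\<Gamma> v) (\<Gamma> ?w)"
    using vertex_in_closed_triangle[of "\<Gamma> u" "\<Gamma> v" "\<Gamma> ?w"] assms(2) by simp
  fix x y assume xy: "(x, y) \<in> D" and x: "\<Gamma> x \<in> closed_triangle (\<Gamma> u) (\<Gamma> v) (\<Gamma> ?w)"
  show "\<Gamma> y \<in> closed_triangle (\<Gamma> u) (\<Gamma> v) (\<Gamma> ?w)"
  proof (cases "x \<in> {u, v, ?w}")
    case True
    then consider "x = v" | "x = ?w" | "x = u" by blast
    then show ?thesis
    proof cases
      case 1
      then show ?thesis using reversed_face_corner[OF assms(1,2)] xy by simp
    next
      case 2
      then show ?thesis using reversed_face_corner[OF t(1)] assms(2) xy t(3)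
        by (simp add: ccw_rotate[of "\<Gamma> u"] closed_triangle_rotate[of "\<Gamma> u"])
    next
      case 3
      then show ?thesis using reversed_face_corner[OF t(2)] assms(2) xy t(4)
        by (simp add: ccw_rotate[of "\<Gamma> ?w" "\<Gamma> u"] closed_triangle_rotate[of "\<Gamma> ?w" "\<Gamma> u"])
    qed
  next
    case False
    show ?thesis
    proof (rule ccontr)
      assume y: "\<Gamma> y \<notin> closed_triangle (\<Gamma> u) (\<Gamma> v) (\<Gamma> ?w)"
      obtain z where z: "z \<in> closed_segment (\<Gamma> x) (\<Gamma> y)"
        "z \<in> closed_segment (\<Gamma> u) (\<Gamma> v) \<or> z \<in> closed_segment (\<Gamma> v) (\<Gamma> ?w) \<or> z \<in> closed_segment (\<Gamma> ?w) (\<Gamma> u)"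
        using segment_leaves_closed_triangle[OF assms(2) x y] by metis
      then obtain a b where ab: "(a, b) \<in> D" "{a, b} \<subseteq> {u, v, ?w}" "z \<in> closed_segment (\<Gamma> a) (\<Gamma> b)"
        using assms(1) t(1,2) by blast
      then have "{x, y} \<noteq> {a, b}" using False by blast
      then obtain i where "i \<in> {x, y}" "i \<in> {a, b}"
        using edges_meet[OF xy ab(1) _ z(1) ab(3)] by blast
      with False ab(2) have "y \<in> {u, v, ?w}" by blast
      with y show False
        using vertex_in_closed_triangle[of "\<Gamma> u" "\<Gamma> v" "\<Gamma> ?w"] assms(2) by auto
    qed
  qed
qed (rule assms(3))

text \<open>A reversed inner face would contain an outer edge \<open>a b\<close>. Points just right
  of its midpoint \<open>?m\<close> are in the unbounded region, so \<open>?m\<close> is on a side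
  of the face and by planarity \<open>a b\<close> is that side. Traversed in the same direction, it
  would make the face outer; in the opposite direction, the points to its right would lie inside the
  triangle.\<close>

lemma inner_dart_positive:
  assumes "(u, v) \<in> D" "(u, v) \<notin> outer_face G"
  shows "ccw (\<Gamma> v) (\<Gamma> u) (\<Gamma> (third u v)) > 0"
proof (rule ccontr)
  let ?w = "third u v"
  let ?T = "closed_triangle (\<Gamma> u) (\<Gamma> v) (\<Gamma> ?w)"
  note t = face_triangle[OF assms(1)]
  assume "\<not> ?thesis"
  with triangle_nondegenerate[OF assms(1)] have pos: "ccw (\<Gamma> u) (\<Gamma> v) (\<Gamma> ?w) > 0"
    by (simp add: ccw_swap[of "\<Gamma> u" "\<Gamma> v"])
  obtain a b where ab: "(a, b) \<in> outer_face G" by (rule outer_face_nonempty)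
  then have abD: "(a, b) \<in> D" using outer_face_subset by blast
  then have in_T: "\<Gamma> a \<in> ?T" "\<Gamma> b \<in> ?T"
    using reversed_face_contains_all[OF assms(1) pos] dart_vertices by auto
  let ?m = "midpoint (\<Gamma> a) (\<Gamma> b)"
  let ?q = "\<lambda>e::real. ?m - of_real e * \<i> * (\<Gamma> b - \<Gamma> a)"
  have out: "\<forall>\<^sub>F e in at_right 0. ?q e \<in> outside (skeleton G \<Gamma>)"
    using planar ab unfolding planar_drawing_def realizes_outer_face_def by blast
  have no: "\<not> (\<forall>\<^sub>F e in at_right 0. ?q e \<in> open_triangle (\<Gamma> u) (\<Gamma> v) (\<Gamma> ?w))"
  proof
    assume "\<forall>\<^sub>F e in at_right 0. ?q e \<in> open_triangle (\<Gamma> u) (\<Gamma> v) (\<Gamma> ?w)"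
    with out have "\<forall>\<^sub>F e::real in at_right 0. False"
      by eventually_elim (use outside_disjoint_triangle[OF assms(1)] pos in blast)
    then show False by simp
  qed
  have "?m \<in> ?T"
    using in_T convex_closed_triangle by (meson closed_segment_subset midpoint_in_closed_segment subsetD)
  moreover have "?m \<notin> open_triangle (\<Gamma> u) (\<Gamma> v) (\<Gamma> ?w)"
  proof
    assume m: "?m \<in> open_triangle (\<Gamma> u) (\<Gamma> v) (\<Gamma> ?w)"
    have "(?q \<longlongrightarrow> ?m - of_real 0 * \<i> * (\<Gamma> b - \<Gamma> a)) (at_right 0)"
      by (intro tendsto_intros)
    with m no show False
      using topological_tendstoD[of ?q ?m "at_right 0" "open_triangle (\<Gamma> u) (\<Gamma> v) (\<Gamma> ?w)"] open_open_triangle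
      by simp
  qed
  ultimately obtain c d where cd: "(c, d) \<in> {(u, v), (v, ?w), (?w, u)}"
    "?m \<in> closed_segment (\<Gamma> c) (\<Gamma> d)"
    using closed_triangle_boundary[OF pos] by blast
  then have cdD: "(c, d) \<in> D" using assms(1) t(1,2) by blast
  have "{a, b} = {c, d}"
  proof (rule ccontr)
    assume "{a, b} \<noteq> {c, d}"
    then obtain i where "i \<in> {a, b}" "?m = \<Gamma> i"
      using edges_meet[OF abD cdD _ midpoint_in_closed_segment cd(2)] by blast
    then have "\<Gamma> a = \<Gamma> b" by (auto simp: midpoint_eq_endpoint)
    then show False using abD dart_irrefl dart_vertices drawing_inj by metis
  qed
  then consider "a = c" "b = d" | "a = d" "b = c" by (auto simp: doubleton_eq_iff)
  then show False
  proof cases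
    case 1
    then show False
      using ab cd(1) assms outer_face_step[of u v] outer_face_step[of v ?w] t(1,3) by auto
  next
    case 2
    have cd_pos: "ccw (\<Gamma> c) (\<Gamma> d) (\<Gamma> (third c d)) > 0"
      "open_triangle (\<Gamma> c) (\<Gamma> d) (\<Gamma> (third c d)) = open_triangle (\<Gamma> u) (\<Gamma> v) (\<Gamma> ?w)"
      using cd(1) pos t(3,4)
      by (auto simp: ccw_rotate[of "\<Gamma> u" "\<Gamma> v" "\<Gamma> ?w"] ccw_rotate[of "\<Gamma> v" "\<Gamma> ?w" "\<Gamma> u"]
         open_triangle_rotate[of "\<Gamma> u" "\<Gamma> v" "\<Gamma> ?w"] open_triangle_rotate[of "\<Gamma> v" "\<Gamma> ?w" "\<Gamma> u"])
    then show False
      using right_of_midpoint[OF cd_pos(1)] no 2 by simp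
  qed
qed

lemma planar_imp_oriented: "oriented G \<Gamma>"
  unfolding oriented_def using inner_dart_positive outer_dart_negative by auto

end

end

subsection \<open>Correctly oriented faces give a planar drawing\<close>

lemma ccw_angle_lt_convex:
  assumes "ccw c x y > 0" "z \<noteq> c" "ccw_angle c x z < ccw_angle c x y"
  shows "ccw c x z \<ge> 0" "ccw c y z < 0"
proof -
  have ne: "x \<noteq> c" "y \<noteq> c" using assms by auto
  define a b where "a = (y - c) / (x - c)" and "b = (z - c) / (x - c)"
  have lt: "Arg2pi b < Arg2pi a" using assms(3) by (simp add: ccw_angle_def a_def b_def)
  have Im: "Im a = ccw c x y / (cmod (x - c))\<^sup>2" "Im b = ccw c x z / (cmod (x - c))\<^sup>2"
    using ccw_rotate[of c x] by (simp_all add: a_def b_def Im_quotient)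
  then have "Im a > 0" using assms(1) ne by simp
  then have a: "Arg2pi a < pi" using Arg2pi_lt_pi[of a] by simp
  with lt have "Im b \<ge> 0" using Arg2pi_le_pi[of b] by simp
  then show "ccw c x z \<ge> 0" using ne Im by (simp add: divide_simps split: if_splits)
  have "a \<noteq> 0" "b \<noteq> 0" using ne assms(2) by (auto simp: a_def b_def)
  moreover have "sin (Arg2pi a - Arg2pi b) > 0"
    using lt a Arg2pi[of b] by (intro sin_gt_zero) auto
  ultimately have "Im (cnj b * a) > 0"
    unfolding Im_cnj_mult_Arg2pi by simp
  then have "ccw c z y > 0"
    using ne unfolding a_def b_def ccw_quotient by (simp add: zero_less_divide_iff)
  then show "ccw c y z < 0"
    by (simp add: ccw_rotate[of c z y] ccw_swap[of z y] ccw_rotate[of c y z] ccw_rotate[of y z c])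
qed

text \<open>\<open>z\<close> lies in the closed wedge swept counterclockwise from \<open>y\<close>
  to \<open>x\<close>. The only direction there whose angle is smaller than that of \<open>y\<close>
  is the direction of \<open>x\<close> itself, which counts as 0 rather than 2 pi.\<close>

lemma ccw_angle_lt_reflex:
  assumes "ccw c x y < 0" "z \<noteq> c" "ccw c x z \<le> 0" "ccw c y z \<ge> 0" "ccw_angle c x z < ccw_angle c x y"
  obtains r where "r > 0" "z = c + r *\<^sub>R (x - c)"
proof -
  have ne: "x \<noteq> c" "y \<noteq> c" using assms by auto
  define a b where "a = (y - c) / (x - c)" and "b = (z - c) / (x - c)"
  have lt: "Arg2pi b < Arg2pi a" using assms(5) by (simp add: ccw_angle_def a_def b_def)
  have "Im b = ccw c x z / (cmod (x - c))\<^sup>2"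
    using ccw_rotate[of c x] by (simp_all add: a_def b_def Im_quotient)
  then have Im_b: "Im b \<le> 0" using assms(3) ne by (simp add: divide_nonpos_pos)
  have nz: "a \<noteq> 0" "b \<noteq> 0" using ne assms(2) by (auto simp: a_def b_def)
  have "Im (cnj a * b) \<ge> 0"
    using assms(4) unfolding a_def b_def ccw_quotient by simp
  moreover have "cmod a * cmod b > 0" using nz by simp
  ultimately have "sin (Arg2pi b - Arg2pi a) \<ge> 0"
    unfolding Im_cnj_mult_Arg2pi by (metis mult_pos_neg not_le)
  then have "\<not> 0 < sin (Arg2pi a - Arg2pi b)"
    by (metis minus_diff_eq neg_0_le_iff_le not_le sin_minus)
  then have "Arg2pi a - Arg2pi b \<ge> pi"
    using lt sin_gt_zero[of "Arg2pi a - Arg2pi b"] by linarith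
  then have "Arg2pi b < pi" using Arg2pi[of a] by linarith
  then have "Arg2pi b = 0"
    using Im_b Arg2pi_lt_pi[of b] Arg2pi[of b] by linarith
  then have "b \<in> \<real>" "Re b \<ge> 0" by (auto simp: Arg2pi_eq_0)
  then obtain r where r: "b = of_real r" "r \<ge> 0" by (auto elim!: Reals_cases)
  with nz have "r > 0" by auto
  moreover have "z = c + r *\<^sub>R (x - c)"
    using r ne by (simp add: b_def field_simps scaleR_conv_of_real)
  ultimately show thesis using that by blast
qed

text \<open>The quotient of inner product and \<open>ccw\<close> is the cotangent of an angle at
  \<open>v\<close>, measured to \<open>q\<close>. The left side is the numerator of the difference
  of two such cotangents, so its sign is that of \<open>ccw v a b\<close>.\<close>

lemma ccw_inner_identity:
  "ccw v a q * ((b - v) \<bullet> (q - v)) - ccw v b q * ((a - v) \<bullet> (q - v)) = ccw v a b * ((q - v) \<bullet> (q - v))"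
  by (simp add: ccw_def inner_complex_def algebra_simps)

section \<open>Counting the faces over a generic point\<close>

context triangulation
begin

context
  fixes \<Gamma> :: "'v drawing"
  assumes oriented: "oriented G \<Gamma>"
begin

text \<open>The full lines through the edges are avoided, not only the edges:
  \<open>Arg_triangle_sum\<close> needs nonzero areas.\<close>

definition generic :: "complex \<Rightarrow> bool" where
  "generic q \<longleftrightarrow> (\<forall>(u, v)\<in>D. ccw (\<Gamma> u) (\<Gamma> v) q \<noteq> 0)"

abbreviation inner_darts :: "('v \<times> 'v) set" where "inner_darts \<equiv> D - outer_face G"

definition tri :: "'v \<times> 'v \<Rightarrow> complex set" where
  "tri = (\<lambda>(u, v). open_triangle (\<Gamma> v) (\<Gamma> u) (\<Gamma> (third u v)))"

definition outer_tri :: "'v \<times> 'v \<Rightarrow> complex set" where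
  "outer_tri = (\<lambda>(u, v). open_triangle (\<Gamma> u) (\<Gamma> v) (\<Gamma> (third u v)))"

lemma inner_ccw: "(u, v) \<in> inner_darts \<Longrightarrow> ccw (\<Gamma> v) (\<Gamma> u) (\<Gamma> (third u v)) > 0"
  using oriented by (auto simp: oriented_def split: if_splits)

lemma outer_ccw: "(u, v) \<in> outer_face G \<Longrightarrow> ccw (\<Gamma> u) (\<Gamma> v) (\<Gamma> (third u v)) > 0"
  using oriented outer_face_subset ccw_swap[of "\<Gamma> u" "\<Gamma> v"] by (fastforce simp: oriented_def split: if_splits)

lemma ccw_neq_0: "(u, v) \<in> D \<Longrightarrow> ccw (\<Gamma> v) (\<Gamma> u) (\<Gamma> (third u v)) \<noteq> 0"
  using oriented by (fastforce simp: oriented_def split: if_splits)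

lemma dart_points_neq: "(u, v) \<in> D \<Longrightarrow> \<Gamma> u \<noteq> \<Gamma> v"
  using ccw_neq_0 by (metis ccw_degenerate(1))

lemma generic_dense:
  assumes "open U" "U \<noteq> {}" obtains q where "q \<in> U" "generic q"
proof -
  let ?F = "(\<lambda>(u, v). {q. ccw (\<Gamma> u) (\<Gamma> v) q = 0}) ` D"
  have "interior (\<Union>?F) = {}"
  proof (rule interior_finite_Union_closed)
    show "finite ?F" using finite_D by simp
    show "closed A \<and> interior A = {}" if "A \<in> ?F" for A
      using that dart_points_neq
      by (auto simp: interior_line intro!: closed_Collect_eq continuous_intros)
  qed
  then have "\<not> U \<subseteq> \<Union>?F"
    using interior_maximal[OF _ assms(1)] assms(2) by blast
  then show thesis using that by (auto simp: generic_def)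
qed

lemma tri_face:
  assumes "(u, v) \<in> D" "d \<in> orbit (face_step G) (u, v)"
  shows "tri d = tri (u, v)"
  using assms(2) face_triangle[OF assms(1)] unfolding face_orbit[OF assms(1)]
  by (auto simp: tri_def open_triangle_rotate[of "\<Gamma> v" "\<Gamma> u"] open_triangle_rotate[of "\<Gamma> (third u v)" "\<Gamma> v"])

lemma outer_tri_face:
  assumes "d \<in> outer_face G" "d' \<in> outer_face G"
  shows "outer_tri d = outer_tri d'"
proof -
  obtain u v where d: "d = (u, v)" by fastforce
  have "(u, v) \<in> D" using assms d outer_face_subset by blast
  from face_triangle[OF this] show ?thesis
    using assms(2) unfolding d outer_face_eq[OF assms(1)[unfolded d]]
    by (auto simp: outer_tri_def open_triangle_rotate[of "\<Gamma> v" "\<Gamma> (third u v)"] open_triangle_rotate[of "\<Gamma> (third u v)" "\<Gamma> u"])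
qed

text \<open>The angle under which a dart is seen from \<open>q\<close> is antisymmetric, so the winding numbers around
  \<open>q\<close> of all faces add up to zero.\<close>

lemma covering_count:
  assumes "generic q"
  shows "card {d \<in> inner_darts. q \<in> tri d} = card {d \<in> outer_face G. q \<in> outer_tri d}"
proof -
  define \<theta> where "\<theta> u v = Arg ((\<Gamma> v - q) / (\<Gamma> u - q))" for u v
  have nz: "ccw (\<Gamma> u) (\<Gamma> v) q \<noteq> 0" if "(u, v) \<in> D" for u v
    using assms that by (auto simp: generic_def)
  have anti: "\<theta> v u = - \<theta> u v" if "(u, v) \<in> D" for u v
  proof -
    have "\<Gamma> u \<noteq> q" "\<Gamma> v \<noteq> q" using nz[OF that] by auto
    then have "Im ((\<Gamma> v - q) / (\<Gamma> u - q)) \<noteq> 0"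
      using nz[OF that] by (simp add: Im_quotient)
    then have "Arg (inverse ((\<Gamma> v - q) / (\<Gamma> u - q))) = - \<theta> u v"
      unfolding Arg_inverse \<theta>_def by (simp add: complex_is_Real_iff)
    then show ?thesis by (simp add: \<theta>_def)
  qed
  have sum0: "(\<Sum>(u, v)\<in>D. \<theta> v u) = 0"
  proof -
    have "(\<Sum>(u, v)\<in>D. \<theta> v u) = (\<Sum>(u, v)\<in>D. - \<theta> u v)"
      using anti by (intro sum.cong) auto
    also have "(\<Sum>(u, v)\<in>D. - \<theta> u v) = - (\<Sum>(u, v)\<in>D. \<theta> u v)"
      by (simp add: sum_negf split_def)
    also have "(\<Sum>(u, v)\<in>D. \<theta> u v) = (\<Sum>(u, v)\<in>D. \<theta> v u)"
      by (rule sum.reindex_bij_witness[where i = prod.swap and j = prod.swap]) (auto intro: dart_sym)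
    finally show ?thesis by simp
  qed
  \<comment> \<open>2 pi times the winding number of the face traversed against its darts. Summing
    over darts counts each face three times, the outer one included.\<close>
  define W where "W = (\<lambda>(u, v). \<theta> v u + \<theta> u (third u v) + \<theta> (third u v) v)"
  have "(\<Sum>d\<in>D. W d) = 0"
  proof -
    let ?f = "\<lambda>(u, v). \<theta> v u"
    have step: "(\<Sum>d\<in>D. g (face_step G d)) = (\<Sum>d\<in>D. g d)" for g :: "'v \<times> 'v \<Rightarrow> real"
      by (rule sum.reindex_bij_betw[OF face_step_bij])
    have "(\<Sum>d\<in>D. W d) = (\<Sum>d\<in>D. ?f d + ?f (face_step G (face_step G d)) + ?f (face_step G d))"
      using face_triangle by (intro sum.cong) (auto simp: W_def face_step_def)
    also have "\<dots> = 0"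
      using step[of ?f] step[of "\<lambda>d. ?f (face_step G d)"] sum0 by (simp add: sum.distrib)
    finally show ?thesis .
  qed
  moreover have "W d = (if q \<in> tri d then 2 * pi else 0)" if d: "d \<in> inner_darts" for d
  proof -
    obtain u v where uv: "d = (u, v)" by fastforce
    with d have "(u, v) \<in> D" by simp
    note t = face_triangle[OF this]
    show ?thesis
      using Arg_triangle_sum[OF inner_ccw[OF d[unfolded uv]], of q] nz[OF dart_sym[OF \<open>(u, v) \<in> D\<close>]]
        nz[OF dart_sym[OF t(2)]] nz[OF dart_sym[OF t(1)]]
      by (simp add: W_def uv \<theta>_def tri_def)
  qed
  moreover have "W d = (if q \<in> outer_tri d then - 2 * pi else 0)" if d: "d \<in> outer_face G" for d
  proof -
    obtain u v where uv: "d = (u, v)" by fastforce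
    with d have uvD: "(u, v) \<in> D" using outer_face_subset by blast
    note t = face_triangle[OF uvD]
    have "W d = - (\<theta> u v + \<theta> v (third u v) + \<theta> (third u v) u)"
      using anti[OF uvD] anti[OF t(1)] anti[OF t(2)] by (simp add: W_def uv)
    then show ?thesis
      using Arg_triangle_sum[OF outer_ccw[OF d[unfolded uv]], of q] nz[OF uvD] nz[OF t(1)] nz[OF t(2)]
      by (simp add: uv \<theta>_def outer_tri_def)
  qed
  moreover have "(\<Sum>d\<in>D. W d) = (\<Sum>d\<in>inner_darts. W d) + (\<Sum>d\<in>outer_face G. W d)"
    using finite_D outer_face_subset by (metis add.commute sum.subset_diff)
  ultimately have "(\<Sum>d\<in>inner_darts. if q \<in> tri d then 2 * pi else 0) +
      (\<Sum>d\<in>outer_face G. if q \<in> outer_tri d then - 2 * pi else 0) = 0"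
    by simp
  moreover have "finite inner_darts" "finite (outer_face G)"
    using finite_D outer_face_subset finite_subset by auto
  ultimately show ?thesis
    by (simp add: sum.If_cases Int_def)
qed

lemma card_outer_face: "finite (outer_face G)" "card (outer_face G) = 3"
  using finite_D outer_face_subset finite_subset face_card[OF outer_face_in_faces] by auto

lemma inner_face:
  assumes "d \<in> inner_darts"
  shows "orbit (face_step G) d \<subseteq> inner_darts" "card (orbit (face_step G) d) = 3"
proof -
  obtain u v where uv: "d = (u, v)" by fastforce
  with assms have uvD: "(u, v) \<in> D" by simp
  have F: "orbit (face_step G) d \<in> faces G" using assms by (auto simp: faces_def)
  show "card (orbit (face_step G) d) = 3" by (rule face_card[OF F])
  have "e \<notin> outer_face G" if "e \<in> orbit (face_step G) d" for e
  proof
    assume "e \<in> outer_face G"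
    then have "outer_face G = orbit (face_step G) e" by (rule face_eq_orbit(1)[OF outer_face_in_faces])
    moreover have "orbit (face_step G) d = orbit (face_step G) e"
      using that by (rule face_eq_orbit(1)[OF F])
    ultimately show False using self_in_face[of d] assms by auto
  qed
  moreover have "e \<in> D" if "e \<in> orbit (face_step G) d" for e
    using that by (rule face_eq_orbit(2)[OF F])
  ultimately show "orbit (face_step G) d \<subseteq> inner_darts" by blast
qed

lemma tri_face_inner:
  assumes "d \<in> inner_darts" "e \<in> orbit (face_step G) d" shows "tri e = tri d"
  using assms tri_face[of "fst d" "snd d" e] by simp

lemma generic_in_outer_tri:
  assumes "generic q" "d \<in> inner_darts" "q \<in> tri d" "e \<in> outer_face G"
  shows "q \<in> outer_tri e"
proof -
  have "d \<in> {d \<in> inner_darts. q \<in> tri d}" using assms(2,3) by simp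
  moreover have "finite {d \<in> inner_darts. q \<in> tri d}" using finite_D by simp
  ultimately have "card {d \<in> inner_darts. q \<in> tri d} > 0"
    unfolding card_gt_0_iff by blast
  then have "card {d \<in> outer_face G. q \<in> outer_tri d} > 0"
    using covering_count[OF assms(1)] by simp
  then show ?thesis using outer_tri_face[OF assms(4)] by (auto simp: card_gt_0_iff)
qed

text \<open>The count over outer darts is at most 3, and a single inner face containing
  \<open>q\<close> already contributes its three darts.\<close>

lemma generic_unique_tri:
  assumes "generic q" "d \<in> inner_darts" "q \<in> tri d" "e \<in> inner_darts" "q \<in> tri e"
  shows "d \<in> orbit (face_step G) e"
proof -
  let ?S = "{d \<in> inner_darts. q \<in> tri d}"
  have fin: "finite ?S" using finite_D by simp
  have "card ?S \<le> 3"
    unfolding covering_count[OF assms(1)] card_outer_face(2)[symmetric]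
    by (rule card_mono[OF card_outer_face(1)]) auto
  moreover have "orbit (face_step G) e \<subseteq> ?S"
    using inner_face(1)[OF assms(4)] tri_face_inner[OF assms(4)] assms(5) by auto
  ultimately have "orbit (face_step G) e = ?S"
    using inner_face(2)[OF assms(4)] fin by (intro card_seteq) auto
  with assms(2,3) show ?thesis by blast
qed

definition closed_tri :: "'v \<times> 'v \<Rightarrow> complex set" where
  "closed_tri = (\<lambda>(u, v). closed_triangle (\<Gamma> v) (\<Gamma> u) (\<Gamma> (third u v)))"

lemma generic_near_closed_tri:
  assumes "d \<in> inner_darts" "p \<in> closed_tri d" "eventually P (nhds p)"
  obtains q where "generic q" "q \<in> tri d" "P q"
proof -
  obtain u v where uv: "d = (u, v)" by fastforce
  obtain U where U: "open U" "p \<in> U" "\<And>q. q \<in> U \<Longrightarrow> P q"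
    using assms(3) by (auto simp: eventually_nhds)
  have "\<forall>\<^sub>F q in nhds p. q \<in> U" using U by (auto simp: eventually_nhds)
  then have "\<exists>q\<in>tri d. q \<in> U"
    using assms(1,2) unfolding uv tri_def closed_tri_def
    by (auto intro!: closed_triangle_limit inner_ccw)
  then have "tri d \<inter> U \<noteq> {}" by blast
  moreover have "open (tri d \<inter> U)"
    using U(1) by (auto simp: tri_def uv open_open_triangle)
  ultimately obtain q where "q \<in> tri d \<inter> U" "generic q" by (metis generic_dense)
  then show thesis using that U(3) by blast
qed

lemma vertex_in_closed_tri:
  assumes "(u, v) \<in> inner_darts"
  shows "\<Gamma> u \<in> closed_tri (u, v)" "\<Gamma> v \<in> closed_tri (u, v)" "\<Gamma> (third u v) \<in> closed_tri (u, v)"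
    "closed_segment (\<Gamma> u) (\<Gamma> v) \<subseteq> closed_tri (u, v)"
  using vertex_in_closed_triangle[OF order.strict_implies_order[OF inner_ccw[OF assms]]]
    closed_segment_subset_closed_triangle[OF order.strict_implies_order[OF inner_ccw[OF assms]]]
  by (auto simp: closed_tri_def closed_segment_commute)

text \<open>If \<open>v\<close> were outside, so would be generic points close to it in an inner
  face at \<open>v\<close>, but every generic point of an inner face is in the outer
  triangle.\<close>

lemma in_outer_closed_triangle:
  assumes "(a, b) \<in> outer_face G" "v \<in> V"
  shows "\<Gamma> v \<in> closed_triangle (\<Gamma> a) (\<Gamma> b) (\<Gamma> (third a b))"
proof (rule ccontr)
  let ?K = "closed_triangle (\<Gamma> a) (\<Gamma> b) (\<Gamma> (third a b))"
  assume "\<Gamma> v \<notin> ?K"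
  then have ev: "\<forall>\<^sub>F q in nhds (\<Gamma> v). q \<notin> ?K"
    using closed_closed_triangle by (intro eventually_nhds_in_open[of "- ?K", simplified]) auto
  obtain u where u: "(u, v) \<in> inner_darts" using inner_dart_exists[OF assms(2)] by blast
  obtain q where "generic q" "q \<in> tri (u, v)" "q \<notin> ?K"
    using generic_near_closed_tri[OF u vertex_in_closed_tri(2)[OF u] ev] by blast
  then show False
    using generic_in_outer_tri[OF _ u _ assms(1)] by (auto simp: outer_tri_def dest: subsetD[OF open_triangle_subset])
qed

lemma sum_rot: "v \<in> V \<Longrightarrow> (\<Sum>u\<in>neighbours G v. f (rot G v u)) = (\<Sum>u\<in>neighbours G v. f u)"
  by (rule sum.reindex_bij_betw[OF rot_bij])

text \<open>Otherwise the slope with respect to \<open>q - \<Gamma> v\<close> would increase strictly with each step of the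
  rotation around \<open>v\<close>.\<close>

lemma rotation_both_sides:
  assumes "v \<in> V" "generic q" "\<And>u. (u, v) \<in> D \<Longrightarrow> (u, v) \<notin> outer_face G"
  shows "\<exists>u. (u, v) \<in> D \<and> ccw (\<Gamma> v) (\<Gamma> u) q > 0" "\<exists>u. (u, v) \<in> D \<and> ccw (\<Gamma> v) (\<Gamma> u) q < 0"
proof -
  let ?N = "neighbours G v"
  let ?c = "\<lambda>u. ccw (\<Gamma> v) (\<Gamma> u) q" and ?e = "\<lambda>u. (\<Gamma> u - \<Gamma> v) \<bullet> (q - \<Gamma> v)"
  have nz: "?c u \<noteq> 0" if "(u, v) \<in> D" for u
    using assms(2) dart_sym[OF that] by (auto simp: generic_def)
  have "\<not> (\<forall>u\<in>?N. \<forall>x\<in>?N. ?c u * ?c x > 0)"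
  proof
    assume same: "\<forall>u\<in>?N. \<forall>x\<in>?N. ?c u * ?c x > 0"
    have "(\<Sum>u\<in>?N. ?e u / ?c u) < (\<Sum>u\<in>?N. ?e (rot G v u) / ?c (rot G v u))"
    proof (rule sum_strict_mono)
      show "finite ?N" by (rule finite_neighbours)
      show "?N \<noteq> {}" using neighbour_exists[OF assms(1)] by (auto simp: neighbours_iff)
      fix u assume u: "u \<in> ?N"
      then have uv: "(u, v) \<in> D" by (simp add: neighbours_iff)
      let ?w = "rot G v u"
      have w: "?w \<in> ?N" using face_triangle(1)[OF uv] dart_sym by (auto simp: neighbours_iff)
      have "q \<noteq> \<Gamma> v" using nz[OF uv] by auto
      then have "(q - \<Gamma> v) \<bullet> (q - \<Gamma> v) > 0" by simp
      then have "?c u * ?e ?w - ?c ?w * ?e u > 0"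
        using inner_ccw[of u v] uv assms(3)[OF uv] unfolding ccw_inner_identity by simp
      moreover have "?c u * ?c ?w > 0" using same u w by blast
      ultimately have "(?c u * ?e ?w - ?c ?w * ?e u) / (?c u * ?c ?w) > 0" by (rule divide_pos_pos)
      moreover have "(?c u * ?e ?w - ?c ?w * ?e u) / (?c u * ?c ?w) = ?e ?w / ?c ?w - ?e u / ?c u"
        using \<open>?c u * ?c ?w > 0\<close> by (subst diff_frac_eq) (auto simp: mult.commute)
      ultimately show "?e u / ?c u < ?e ?w / ?c ?w" by simp
    qed
    with sum_rot[OF assms(1), of "\<lambda>u. ?e u / ?c u"] show False by simp
  qed
  then obtain u x where "u \<in> ?N" "x \<in> ?N" "\<not> ?c u * ?c x > 0" by blast
  then have "(u, v) \<in> D" "(x, v) \<in> D" "?c u * ?c x < 0"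
    using nz by (auto simp: neighbours_iff not_less order.order_iff_strict)
  then show "\<exists>u. (u, v) \<in> D \<and> ?c u > 0" "\<exists>u. (u, v) \<in> D \<and> ?c u < 0"
    by (auto simp: mult_less_0_iff)
qed

text \<open>Close to \<open>v\<close> only the two sides meeting at \<open>v\<close> decide
  membership in a face. It suffices to find consecutive neighbours where
  \<open>ccw (\<Gamma> v) (\<Gamma> u) q\<close> turns from positive to negative. Both signs occur:
  at a boundary vertex because \<open>q\<close> is in the outer triangle, elsewhere by
  \<open>rotation_both_sides\<close>.\<close>

lemma star_covers_vertex:
  assumes "v \<in> V"
  shows "\<forall>\<^sub>F q in nhds (\<Gamma> v). generic q \<longrightarrow> (\<forall>d\<in>outer_face G. q \<in> outer_tri d) \<longrightarrow>
    (\<exists>u. (u, v) \<in> inner_darts \<and> q \<in> tri (u, v))"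
proof -
  let ?N = "{u \<in> neighbours G v. (u, v) \<in> inner_darts}"
  have "\<forall>\<^sub>F q in nhds (\<Gamma> v). \<forall>u\<in>?N. ccw (\<Gamma> u) (\<Gamma> (third u v)) q > 0"
  proof (rule eventually_ball_finite)
    show "finite ?N" using finite_neighbours by simp
    show "\<forall>u\<in>?N. \<forall>\<^sub>F q in nhds (\<Gamma> v). ccw (\<Gamma> u) (\<Gamma> (third u v)) q > 0"
      using inner_ccw ccw_rotate by (auto intro!: eventually_ccw_pos)
  qed
  then show ?thesis
  proof eventually_elim
    case (elim q)
    let ?R = "\<lambda>u. ccw (\<Gamma> v) (\<Gamma> u) q > 0"
    show ?case
    proof (intro impI)
      assume gen: "generic q" and out: "\<forall>d\<in>outer_face G. q \<in> outer_tri d"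
      have outer: "\<not> ?R a \<and> ?R (third a v) \<and> (third a v, v) \<in> D" if "(a, v) \<in> outer_face G" for a
      proof -
        have "q \<in> outer_tri (a, v)" using out that by blast
        then show ?thesis
          using that outer_face_subset face_triangle(1) dart_sym ccw_swap[of "\<Gamma> v" "\<Gamma> a" q]
          by (auto simp: outer_tri_def open_triangle_def)
      qed
      have "(\<exists>u. (u, v) \<in> D \<and> ?R u) \<and> (\<exists>u. (u, v) \<in> D \<and> \<not> ?R u)"
      proof (cases "\<exists>a. (a, v) \<in> outer_face G")
        case True
        then show ?thesis using outer outer_face_subset by blast
      next
        case False
        then show ?thesis using rotation_both_sides[OF assms gen] by (meson order.asym)
      qed
      then obtain u0 u1 where u01: "(u0, v) \<in> D" "?R u0" "(u1, v) \<in> D" "\<not> ?R u1" by blast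
      obtain u where u: "(u, v) \<in> D" "?R u" "\<not> ?R (rot G v u)"
        using rot_induct[of u0 v ?R u1] u01 by blast
      then have inn: "(u, v) \<in> inner_darts" using outer by blast
      have "ccw (\<Gamma> (third u v)) (\<Gamma> v) q \<noteq> 0"
        using gen dart_sym[OF face_triangle(1)[OF u(1)]] by (auto simp: generic_def)
      with u(3) have "ccw (\<Gamma> (third u v)) (\<Gamma> v) q > 0"
        using ccw_swap[of "\<Gamma> (third u v)" "\<Gamma> v" q] by simp
      then have "q \<in> tri (u, v)"
        using elim inn u(2) by (auto simp: tri_def open_triangle_def neighbours_iff)
      with inn show "\<exists>u. (u, v) \<in> inner_darts \<and> q \<in> tri (u, v)" by blast
    qed
  qed
qed

lemma open_segment_ccw:
  assumes "p \<in> open_segment a b" "ccw a b c > 0" shows "ccw b c p > 0" "ccw c a p > 0"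
proof -
  obtain t where t: "0 < t" "t < 1" "p = (1 - t) *\<^sub>R a + t *\<^sub>R b"
    using assms(1) by (auto simp: in_segment)
  then show "ccw b c p > 0" "ccw c a p > 0"
    using assms(2) ccw_rotate[of a b c] ccw_rotate[of b c a] by (simp_all add: ccw_affine)
qed

text \<open>Close to an inner point of the edge, only the sign at this edge decides. If the dart is
  outer, the two premises on \<open>q\<close> contradict each other.\<close>

lemma half_star_covers_edge:
  assumes "(u, v) \<in> D" "p \<in> open_segment (\<Gamma> u) (\<Gamma> v)"
  shows "\<forall>\<^sub>F q in nhds p. ccw (\<Gamma> v) (\<Gamma> u) q > 0 \<longrightarrow> (\<forall>d\<in>outer_face G. q \<in> outer_tri d) \<longrightarrow>
    (u, v) \<in> inner_darts \<and> q \<in> tri (u, v)"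
proof (cases "(u, v) \<in> outer_face G")
  case True
  then show ?thesis
    using ccw_swap[of "\<Gamma> u" "\<Gamma> v"] by (force simp: outer_tri_def open_triangle_def intro!: always_eventually)
next
  case False
  then have inn: "(u, v) \<in> inner_darts" using assms(1) by simp
  have "\<forall>\<^sub>F q in nhds p. ccw (\<Gamma> u) (\<Gamma> (third u v)) q > 0"
    "\<forall>\<^sub>F q in nhds p. ccw (\<Gamma> (third u v)) (\<Gamma> v) q > 0"
    using open_segment_ccw[OF _ inner_ccw[OF inn], of p] assms(2)
    by (auto intro!: eventually_ccw_pos simp: open_segment_commute)
  then show ?thesis
    by eventually_elim (use inn in \<open>auto simp: tri_def open_triangle_def\<close>)
qed

text \<open>A generic point of the face close to \<open>\<Gamma> v\<close> is also in some face at
  \<open>v\<close> by \<open>star_covers_vertex\<close>; by uniqueness the two faces are the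
  same.\<close>

lemma vertex_in_closed_tri_imp:
  assumes "(x, y) \<in> inner_darts" "v \<in> V" "\<Gamma> v \<in> closed_tri (x, y)"
  shows "v \<in> {x, y, third x y}"
proof -
  obtain q where q: "generic q" "q \<in> tri (x, y)"
    "generic q \<longrightarrow> (\<forall>d\<in>outer_face G. q \<in> outer_tri d) \<longrightarrow> (\<exists>u. (u, v) \<in> inner_darts \<and> q \<in> tri (u, v))"
    using generic_near_closed_tri[OF assms(1,3) star_covers_vertex[OF assms(2)]] by blast
  then obtain u where u: "(u, v) \<in> inner_darts" "q \<in> tri (u, v)"
    using generic_in_outer_tri[OF q(1) assms(1) q(2)] by blast
  have "(u, v) \<in> orbit (face_step G) (x, y)"
    by (rule generic_unique_tri[OF q(1) u assms(1) q(2)])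
  then show ?thesis using assms(1) by (auto simp: face_orbit)
qed

lemma edge_in_closed_tri_imp:
  assumes "d \<in> inner_darts" "(u, v) \<in> D" "p \<in> open_segment (\<Gamma> u) (\<Gamma> v)" "p \<in> closed_tri d"
  shows "d \<in> orbit (face_step G) (u, v) \<or> d \<in> orbit (face_step G) (v, u)"
proof -
  have "\<forall>\<^sub>F q in nhds p. generic q \<longrightarrow> (\<forall>d\<in>outer_face G. q \<in> outer_tri d) \<longrightarrow>
    (u, v) \<in> inner_darts \<and> q \<in> tri (u, v) \<or> (v, u) \<in> inner_darts \<and> q \<in> tri (v, u)"
    using half_star_covers_edge[OF assms(2,3)]
      half_star_covers_edge[OF dart_sym[OF assms(2)] assms(3)[unfolded open_segment_commute[of "\<Gamma> u"]]]
  proof eventually_elim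
    case (elim q)
    have "generic q \<Longrightarrow> ccw (\<Gamma> v) (\<Gamma> u) q > 0 \<or> ccw (\<Gamma> u) (\<Gamma> v) q > 0"
      using assms(2) ccw_swap[of "\<Gamma> v" "\<Gamma> u" q] by (auto simp: generic_def)
    with elim show ?case by blast
  qed
  then obtain q where q: "generic q" "q \<in> tri d"
    "generic q \<longrightarrow> (\<forall>d\<in>outer_face G. q \<in> outer_tri d) \<longrightarrow>
      (u, v) \<in> inner_darts \<and> q \<in> tri (u, v) \<or> (v, u) \<in> inner_darts \<and> q \<in> tri (v, u)"
    by (rule generic_near_closed_tri[OF assms(1,4)])
  then have "(u, v) \<in> inner_darts \<and> q \<in> tri (u, v) \<or> (v, u) \<in> inner_darts \<and> q \<in> tri (v, u)"
    using generic_in_outer_tri[OF q(1) assms(1) q(2)] by blast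
  then show ?thesis using generic_unique_tri[OF q(1) assms(1) q(2)] by blast
qed

section \<open>Injectivity, crossings, rotation and outer face of an oriented drawing\<close>

lemma oriented_inj: "inj_on \<Gamma> V"
proof (rule inj_onI)
  fix v x assume *: "v \<in> V" "x \<in> V" "\<Gamma> v = \<Gamma> x"
  obtain u where u: "(u, x) \<in> inner_darts" using inner_dart_exists[OF *(2)] by blast
  have "v \<in> {u, x, third u x}"
    using vertex_in_closed_tri_imp[OF u *(1)] vertex_in_closed_tri(2)[OF u] *(3) by simp
  moreover have "\<Gamma> u \<noteq> \<Gamma> x" "\<Gamma> x \<noteq> \<Gamma> (third u x)"
    using u dart_points_neq face_triangle(1) by blast+
  ultimately show "v = x" using *(3) by auto
qed

lemma inner_side:
  assumes "(x, y) \<in> D"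
  obtains a b where "(a, b) \<in> inner_darts" "{a, b} = {x, y}"
  using assms outer_face_not_reversed dart_sym by blast

lemma oriented_vertex_not_on_edge:
  assumes "(x, y) \<in> D" "v \<in> V" "\<Gamma> v \<in> closed_segment (\<Gamma> x) (\<Gamma> y)"
  shows "v \<in> {x, y}"
proof -
  obtain a b where ab: "(a, b) \<in> inner_darts" "{a, b} = {x, y}" by (rule inner_side[OF assms(1)])
  then have seg: "\<Gamma> v \<in> closed_segment (\<Gamma> b) (\<Gamma> a)"
    using assms(3) by (metis closed_segment_commute doubleton_eq_iff)
  then have "v \<in> {a, b, third a b}"
    using vertex_in_closed_tri_imp[OF ab(1) assms(2)] vertex_in_closed_tri(4)[OF ab(1)]
    by (auto simp: closed_segment_commute)
  moreover have "ccw (\<Gamma> b) (\<Gamma> a) (\<Gamma> v) = 0"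
    using seg by (auto simp: in_segment ccw_affine)
  then have "v \<noteq> third a b" using inner_ccw[OF ab(1)] by auto
  ultimately show ?thesis using ab(2) by auto
qed

text \<open>The second edge is a side of an inner face, so \<open>p\<close> is in that closed face
  and the face must be one of the two at \<open>u v\<close>. Then \<open>p\<close> would be on two
  of its sides without being a corner.\<close>

lemma oriented_edges_cross:
  assumes "(u, v) \<in> D" "(x, y) \<in> D" "{u, v} \<noteq> {x, y}"
    "p \<in> open_segment (\<Gamma> u) (\<Gamma> v)" "p \<in> closed_segment (\<Gamma> x) (\<Gamma> y)"
  shows False
proof -
  have not_adjacent: "p \<notin> closed_segment (\<Gamma> b) (\<Gamma> (third a b))" "p \<notin> closed_segment (\<Gamma> (third a b)) (\<Gamma> a)"
    if "(a, b) \<in> D" "{a, b} = {u, v}" for a b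
  proof -
    have p: "p \<in> open_segment (\<Gamma> a) (\<Gamma> b)"
      using that(2) assms(4) by (auto simp: doubleton_eq_iff open_segment_commute)
    then obtain t where t: "0 < t" "t < 1" "p = (1 - t) *\<^sub>R \<Gamma> a + t *\<^sub>R \<Gamma> b"
      by (auto simp: in_segment)
    let ?w = "third a b"
    have nz: "ccw (\<Gamma> b) (\<Gamma> ?w) (\<Gamma> a) \<noteq> 0" "ccw (\<Gamma> ?w) (\<Gamma> a) (\<Gamma> b) \<noteq> 0"
      using ccw_neq_0[OF that(1)] ccw_rotate ccw_swap by (metis neg_equal_0_iff_equal)+
    have "ccw (\<Gamma> b) (\<Gamma> ?w) p \<noteq> 0" "ccw (\<Gamma> ?w) (\<Gamma> a) p \<noteq> 0"
      using t nz by (simp_all add: ccw_affine)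
    then show "p \<notin> closed_segment (\<Gamma> b) (\<Gamma> ?w)" "p \<notin> closed_segment (\<Gamma> ?w) (\<Gamma> a)"
      by (auto simp: in_segment ccw_affine)
  qed
  obtain a b where ab: "(a, b) \<in> inner_darts" "{a, b} = {x, y}" by (rule inner_side[OF assms(2)])
  then have seg: "p \<in> closed_segment (\<Gamma> a) (\<Gamma> b)"
    using assms(5) by (metis closed_segment_commute doubleton_eq_iff)
  then have "p \<in> closed_tri (a, b)" using vertex_in_closed_tri(4)[OF ab(1)] by blast
  then have "(a, b) \<in> orbit (face_step G) (u, v) \<or> (a, b) \<in> orbit (face_step G) (v, u)"
    by (rule edge_in_closed_tri_imp[OF ab(1) assms(1,4)])
  then obtain c d where cd: "(c, d) \<in> D" "{c, d} = {u, v}" "(a, b) \<in> orbit (face_step G) (c, d)"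
    using assms(1) dart_sym by blast
  then show False
    using seg not_adjacent[OF cd(1,2)] ab(2) assms(3) by (auto simp: face_orbit)
qed

lemma oriented_straight_line_planar: "straight_line_planar G \<Gamma>"
proof -
  have "p \<in> \<Gamma> ` ({u, v} \<inter> {x, y})"
    if uv: "(u, v) \<in> D" "(x, y) \<in> D" "{u, v} \<noteq> {x, y}"
      and p: "p \<in> closed_segment (\<Gamma> u) (\<Gamma> v)" "p \<in> closed_segment (\<Gamma> x) (\<Gamma> y)" for u v x y p
  proof -
    have "p \<notin> open_segment (\<Gamma> u) (\<Gamma> v)" using oriented_edges_cross uv p by blast
    then obtain i where i: "i \<in> {u, v}" "p = \<Gamma> i"
      using p(1) by (auto simp: open_segment_def)
    then have "i \<in> {x, y}"
      using oriented_vertex_not_on_edge[OF uv(2), of i] uv(1) p(2) dart_vertices by blast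
    with i show ?thesis by blast
  qed
  then show ?thesis
    unfolding straight_line_planar_def using oriented_inj by blast
qed

text \<open>Suppose \<open>x\<close> comes strictly before \<open>third u v\<close>. In an inner
  face, the edge \<open>v x\<close> would start inside the face, so this face would be adjacent to
  it. In the outer face, containment in the outer triangle leaves only the ray through
  \<open>u\<close>, and the edges would overlap.\<close>

lemma oriented_realizes_rotation: "realizes_rotation G \<Gamma>"
proof -
  have "ccw_angle (\<Gamma> v) (\<Gamma> u) (\<Gamma> (rot G v u)) \<le> ccw_angle (\<Gamma> v) (\<Gamma> u) (\<Gamma> x)"
    if uv: "(u, v) \<in> D" and xv: "(x, v) \<in> D" and "x \<noteq> u" for u v x
  proof (rule ccontr)
    let ?w = "third u v"
    note t = face_triangle[OF uv]
    note ver = dart_vertices[OF uv] dart_vertices[OF xv]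
    assume "\<not> ?thesis"
    then have lt: "ccw_angle (\<Gamma> v) (\<Gamma> u) (\<Gamma> x) < ccw_angle (\<Gamma> v) (\<Gamma> u) (\<Gamma> ?w)" by simp
    have ne: "\<Gamma> x \<noteq> \<Gamma> v" by (rule dart_points_neq[OF xv])
    show False
    proof (cases "(u, v) \<in> outer_face G")
      case True
      have "\<Gamma> x \<in> closed_triangle (\<Gamma> u) (\<Gamma> v) (\<Gamma> ?w)"
        by (rule in_outer_closed_triangle[OF True ver(3)])
      then have "ccw (\<Gamma> v) (\<Gamma> u) (\<Gamma> x) \<le> 0" "ccw (\<Gamma> v) (\<Gamma> ?w) (\<Gamma> x) \<ge> 0"
        using ccw_swap[of "\<Gamma> u" "\<Gamma> v"] by (auto simp: closed_triangle_def)
      moreover have "ccw (\<Gamma> v) (\<Gamma> u) (\<Gamma> ?w) < 0"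
        using outer_ccw[OF True] ccw_swap[of "\<Gamma> u" "\<Gamma> v"] by simp
      ultimately obtain r where r: "r > 0" "\<Gamma> x = \<Gamma> v + r *\<^sub>R (\<Gamma> u - \<Gamma> v)"
        using ccw_angle_lt_reflex[OF _ ne _ _ lt] by blast
      have "\<Gamma> x \<in> closed_segment (\<Gamma> v) (\<Gamma> u) \<or> \<Gamma> u \<in> closed_segment (\<Gamma> v) (\<Gamma> x)"
      proof (cases "r \<le> 1")
        case True
        then have "\<Gamma> x \<in> closed_segment (\<Gamma> v) (\<Gamma> u)"
          unfolding in_segment r(2) using r(1) by (intro exI[of _ r]) (simp add: algebra_simps)
        then show ?thesis ..
      next
        case False
        then have "\<Gamma> u = (1 - 1 / r) *\<^sub>R \<Gamma> v + (1 / r) *\<^sub>R \<Gamma> x"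
          using r(1) by (simp add: r(2) algebra_simps)
        then have "\<Gamma> u \<in> closed_segment (\<Gamma> v) (\<Gamma> x)"
          unfolding in_segment using False by (intro exI[of _ "1 / r"]) auto
        then show ?thesis ..
      qed
      then show False
        using oriented_vertex_not_on_edge[OF dart_sym[OF uv] ver(3)]
          oriented_vertex_not_on_edge[OF dart_sym[OF xv] ver(1)]
          \<open>x \<noteq> u\<close> dart_irrefl[OF xv] dart_irrefl[OF uv] by auto
    next
      case False
      then have inn: "(u, v) \<in> inner_darts" using uv by simp
      note pos = inner_ccw[OF inn]
      note sides = ccw_angle_lt_convex[OF pos ne lt]
      let ?q = "\<lambda>s. \<Gamma> v + s *\<^sub>R (\<Gamma> x - \<Gamma> v)"
      have "((\<lambda>s. ccw (\<Gamma> u) (\<Gamma> ?w) (?q s)) \<longlongrightarrow> ccw (\<Gamma> u) (\<Gamma> ?w) (?q 0)) (at_right 0)"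
        by (intro tendsto_intros)
      then have "\<forall>\<^sub>F s in at_right 0. ccw (\<Gamma> u) (\<Gamma> ?w) (?q s) > 0"
        using pos ccw_rotate[of "\<Gamma> v" "\<Gamma> u" "\<Gamma> ?w"] by (auto dest!: order_tendstoD(1)[where a = 0])
      moreover have "\<forall>\<^sub>F s in at_right (0::real). 0 < s \<and> s < 1"
        by (auto simp: eventually_at_right_field intro!: exI[of _ 1])
      ultimately have "\<forall>\<^sub>F s in at_right 0. ccw (\<Gamma> u) (\<Gamma> ?w) (?q s) > 0 \<and> 0 < s \<and> s < 1"
        by (rule eventually_conj)
      then obtain s where s: "ccw (\<Gamma> u) (\<Gamma> ?w) (?q s) > 0" "0 < s" "s < 1"
        using eventually_happens[of _ "at_right (0::real)"] by force
      have "ccw (\<Gamma> ?w) (\<Gamma> v) (\<Gamma> x) > 0"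
        using sides(2) ccw_swap[of "\<Gamma> v" "\<Gamma> ?w"] by simp
      then have "?q s \<in> closed_tri (u, v)"
        using s sides(1) by (simp add: closed_tri_def closed_triangle_def ccw_affine')
      moreover have "?q s \<in> open_segment (\<Gamma> x) (\<Gamma> v)"
        unfolding in_segment using s(2,3) ne by (intro conjI exI[of _ "1 - s"]) (auto simp: algebra_simps)
      ultimately have "(u, v) \<in> orbit (face_step G) (x, v) \<or> (u, v) \<in> orbit (face_step G) (v, x)"
        using edge_in_closed_tri_imp[OF inn xv] by blast
      then have "x = ?w"
        using \<open>x \<noteq> u\<close> dart_irrefl[OF xv] dart_irrefl[OF uv] face_triangle[OF xv] face_triangle[OF dart_sym[OF xv]]
        by (auto simp: face_orbit[OF xv] face_orbit[OF dart_sym[OF xv]])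
      with sides(2) show False by simp
    qed
  qed
  then show ?thesis
    unfolding realizes_rotation_def by (auto simp: neighbours_iff)
qed

text \<open>The whole drawing is in the closed outer triangle, and the complement of a convex
  bounded set lies in the unbounded region.\<close>

lemma oriented_realizes_outer_face: "realizes_outer_face G \<Gamma>"
proof -
  have "midpoint (\<Gamma> u) (\<Gamma> v) - of_real e * \<i> * (\<Gamma> v - \<Gamma> u) \<in> outside (skeleton G \<Gamma>)" (is "?q \<in> _")
    if uv: "(u, v) \<in> outer_face G" and e: "0 < e" for u v and e :: real
  proof -
    let ?K = "closed_triangle (\<Gamma> u) (\<Gamma> v) (\<Gamma> (third u v))"
    have "skeleton G \<Gamma> \<subseteq> ?K"
      unfolding skeleton_def
      using in_outer_closed_triangle[OF uv] dart_vertices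
      by (auto dest!: closed_segment_subset[OF _ _ convex_closed_triangle, THEN subsetD, rotated 2])
    then have "outside ?K \<subseteq> outside (skeleton G \<Gamma>)" by (rule outside_mono)
    moreover have "outside ?K = - ?K" by (rule outside_convex[OF convex_closed_triangle])
    moreover have "ccw (\<Gamma> v) (\<Gamma> u) ?q > 0"
      using uv outer_face_subset by (intro ccw_right_of_midpoint dart_points_neq e) auto
    then have "?q \<notin> ?K"
      using ccw_swap[of "\<Gamma> u" "\<Gamma> v" ?q] by (auto simp: closed_triangle_def)
    ultimately show ?thesis by blast
  qed
  then show ?thesis
    unfolding realizes_outer_face_def
    by (auto simp: eventually_at_right_field intro!: exI[of _ 1])
qed

lemma oriented_imp_planar: "planar_drawing G \<Gamma>"
  unfolding planar_drawing_def
  using oriented_straight_line_planar oriented_realizes_rotation oriented_realizes_outer_face by blast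

end

lemma planar_iff_oriented: "planar_drawing G \<Gamma> \<longleftrightarrow> oriented G \<Gamma>"
  using planar_imp_oriented oriented_imp_planar by blast

end

subsection \<open>Unidirectional motion and contractions\<close>

definition cross :: "complex \<Rightarrow> complex \<Rightarrow> real" where
  "cross x y = Im (cnj x * y)"

lemma ccw_cross: "ccw x y z = cross (y - x) (z - x)"
  by (simp add: ccw_def cross_def)

lemma cross_algebra:
  "cross (x + y) z = cross x z + cross y z" "cross x (y + z) = cross x y + cross x z"
  "cross (r *\<^sub>R x) y = r * cross x y" "cross x (r *\<^sub>R y) = r * cross x y"
  "cross x x = 0"
  by (simp_all add: cross_def algebra_simps)

lemma cross_swap: "cross y x = - cross x y"
  by (simp add: cross_def algebra_simps)

text \<open>The Grassmann-Pluecker relation of four plane vectors. It combines the two cone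
  conditions on \<open>w\<close> into one statement about
  \<open>cross l w * cross b e\<close>.\<close>

lemma cross_pluecker: "cross l b * cross w e + cross l e * cross b w = cross l w * cross b e"
  by (simp add: cross_def algebra_simps)

lemma cross_eq_0_imp:
  assumes "cross l b = 0" "l \<noteq> 0" obtains x where "b = x *\<^sub>R l"
proof -
  have "Im (b / l) = 0"
    using assms(1) by (simp add: Im_divide cross_def algebra_simps)
  then obtain x where "b / l = of_real x" by (metis complex_is_Real_iff Reals_cases)
  then show thesis using that[of x] assms(2) by (simp add: field_simps scaleR_conv_of_real)
qed

lemma affine_sign_constant:
  fixes c0 c1 :: real
  assumes "\<And>t. t \<in> {0..1} \<Longrightarrow> c0 + t * (c1 - c0) \<noteq> 0"
  shows "c0 * c1 > 0"
proof (rule ccontr)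
  assume "\<not> ?thesis"
  moreover have "c0 \<noteq> 0" "c1 \<noteq> 0" using assms[of 0] assms[of 1] by auto
  ultimately have "c0 * c1 < 0" by (simp add: not_less order.order_iff_strict)
  then consider "c0 < 0" "c1 > 0" | "c0 > 0" "c1 < 0" by (auto simp: mult_less_0_iff)
  then have "c0 / (c0 - c1) \<in> {0..1} \<and> c0 + c0 / (c0 - c1) * (c1 - c0) = 0"
    by cases (auto simp: field_simps)
  with assms show False by blast
qed

text \<open>A vector parallel to \<open>l\<close> that moves along \<open>l\<close> without
  vanishing keeps its direction.\<close>

lemma parallel_sign_constant:
  assumes "l \<noteq> 0" "b1 = b0 + s *\<^sub>R l" "\<And>t. t \<in> {0..1} \<Longrightarrow> b0 + (t * s) *\<^sub>R l \<noteq> 0"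
    "cross l b0 = 0" "cross b0 w > 0"
  shows "cross b1 w > 0"
proof -
  obtain x where x: "b0 = x *\<^sub>R l" using cross_eq_0_imp assms(1,4) by metis
  have "x + t * (x + s - x) \<noteq> 0" if "t \<in> {0..1}" for t
    using assms(3)[OF that] by (auto simp: x simp flip: scaleR_add_left)
  then have "x * (x + s) > 0" by (rule affine_sign_constant)
  moreover have "x * cross l w > 0" using assms(5) by (simp add: x cross_algebra)
  ultimately have "(x + s) * cross l w > 0"
    by (auto simp: zero_less_mult_iff)
  then show ?thesis by (simp add: assms(2) x cross_algebra algebra_simps)
qed

text \<open>The directions in which \<open>p\<close> may leave \<open>a\<close> form the open cone
  \<open>cross b w > 0\<close>, \<open>cross w e > 0\<close>. When \<open>b\<close> and \<open>e\<close> move parallel to \<open>l\<close> without the rays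
  through them ever coinciding, the projection of this cone along \<open>l\<close> does not change.\<close>

lemma cone_transfer:
  fixes b0 b1 e0 e1 l w :: complex
  assumes l: "l \<noteq> 0" and b1: "b1 = b0 + s *\<^sub>R l" and e1: "e1 = e0 + r *\<^sub>R l"
    and bnz: "\<And>t. t \<in> {0..1} \<Longrightarrow> b0 + (t * s) *\<^sub>R l \<noteq> 0"
    and enz: "\<And>t. t \<in> {0..1} \<Longrightarrow> e0 + (t * r) *\<^sub>R l \<noteq> 0"
    and rays: "\<And>t c. t \<in> {0..1} \<Longrightarrow> c > 0 \<Longrightarrow> e0 + (t * r) *\<^sub>R l \<noteq> c *\<^sub>R (b0 + (t * s) *\<^sub>R l)"
    and w: "cross b0 w > 0" "cross w e0 > 0"
  obtains k where "cross b1 (w + k *\<^sub>R l) > 0" "cross (w + k *\<^sub>R l) e1 > 0"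
proof -
  \<comment> \<open>\<open>B\<close> and \<open>E\<close> are constant in time because the motion
    adds multiples of \<open>l\<close>. The two conditions at the end become affine in
    \<open>k\<close>.\<close>
  define B E P Q where "B = cross l b0" and "E = cross l e0" and "P = cross b1 w" and "Q = cross w e1"
  have eqs: "cross b1 (w + k *\<^sub>R l) = P - k * B" "cross (w + k *\<^sub>R l) e1 = Q + k * E" for k
    by (simp_all add: B_def E_def P_def Q_def b1 e1 cross_algebra cross_swap[of l])
  have P: "P > 0" if "B = 0"
    using parallel_sign_constant[OF l b1 bnz _ w(1)] that by (simp add: P_def B_def)
  have Q: "Q > 0" if "E = 0"
  proof -
    have "cross e0 (- w) > 0" using w(2) by (simp add: cross_def algebra_simps)
    then have "cross e1 (- w) > 0"
      using parallel_sign_constant[OF l e1 enz] that by (simp add: E_def)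
    then show ?thesis by (simp add: Q_def cross_def algebra_simps)
  qed
  have "\<exists>k. P - k * B > 0 \<and> Q + k * E > 0"
  proof (cases "B = 0 \<or> E = 0")
    case True
    then consider "B = 0" "E = 0" | "B = 0" "E \<noteq> 0" | "B \<noteq> 0" "E = 0" by blast
    then show ?thesis
    proof cases
      case 1
      then show ?thesis using P Q by (intro exI[of _ 0]) simp
    next
      case 2
      then show ?thesis using P by (intro exI[of _ "(1 - Q) / E"]) simp
    next
      case 3
      then show ?thesis using Q by (intro exI[of _ "(P - 1) / B"]) simp
    qed
  next
    case False
    then have "B > 0 \<or> B < 0" "E > 0 \<or> E < 0" by auto
    \<comment> \<open>Opposite signs bound \<open>k\<close> from the same side. Equal signs bound it
      from both sides, and the interval has to be shown nonempty.\<close>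
    then consider "B > 0" "E < 0" | "B < 0" "E > 0" | "B * E > 0"
      by (auto simp: zero_less_mult_iff)
    then show ?thesis
    proof cases
      case 1
      define k where "k = min (P / B) (- Q / E) - 1"
      have "k < P / B" "k < - Q / E" by (auto simp: k_def)
      with 1 have "P - k * B > 0" "Q + k * E > 0" by (auto simp: field_simps)
      then show ?thesis by blast
    next
      case 2
      define k where "k = max (P / B) (- Q / E) + 1"
      have "P / B < k" "- Q / E < k" by (auto simp: k_def)
      with 2 have "P - k * B > 0" "Q + k * E > 0" by (auto simp: field_simps)
      then show ?thesis by blast
    next
      case 3
      \<comment> \<open>The sign of the angle from \<open>b\<close> to \<open>e\<close>. A change of
        sign would make the two vectors parallel at some time, with a positive factor since
        \<open>B\<close> and \<open>E\<close> agree in sign, so the rays would coincide. The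
        Pluecker relation carries this sign over to the endpoints of the interval for
        \<open>k\<close>.\<close>
      define c0 c1 where "c0 = cross b0 e0" and "c1 = cross b1 e1"
      have c_t: "cross (b0 + (t * s) *\<^sub>R l) (e0 + (t * r) *\<^sub>R l) = c0 + t * (c1 - c0)" for t
        by (simp add: c0_def c1_def b1 e1 cross_algebra algebra_simps)
      have "c0 + t * (c1 - c0) \<noteq> 0" if t: "t \<in> {0..1}" for t
      proof
        let ?b = "b0 + (t * s) *\<^sub>R l" and ?e = "e0 + (t * r) *\<^sub>R l"
        assume "c0 + t * (c1 - c0) = 0"
        then have "cross ?b ?e = 0" by (simp add: c_t)
        then obtain c where c: "?e = c *\<^sub>R ?b" using cross_eq_0_imp bnz[OF t] by metis
        have "cross l ?b = B" "cross l ?e = E" by (simp_all add: B_def E_def cross_algebra)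
        then have "E = c * B" unfolding c by (simp add: cross_algebra)
        with 3 have "c * (B * B) > 0" by (simp add: mult_ac)
        moreover have "B * B > 0" using False by (simp add: zero_less_mult_iff) linarith
        ultimately have "c > 0" by (rule zero_less_mult_pos2)
        with rays[OF t] c show False by blast
      qed
      then have c: "c0 * c1 > 0" by (rule affine_sign_constant)
      have 0: "B * cross w e0 + E * cross b0 w = cross l w * c0"
        unfolding B_def E_def c0_def by (rule cross_pluecker)
      have 1: "B * Q + E * P = cross l w * c1"
        using cross_pluecker[of l b1 w e1]
        by (simp add: B_def E_def c1_def P_def Q_def b1 e1 cross_algebra)
      show ?thesis
      proof (cases "B > 0")
        case True
        with 3 have E: "E > 0" by (simp add: zero_less_mult_iff)
        then have "cross l w * c0 > 0" using 0 True w by (metis add_pos_pos mult_pos_pos)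
        with c have "cross l w * c1 > 0" by (auto simp: zero_less_mult_iff)
        then have "- Q / E < P / B" using 1 True E by (simp add: field_simps)
        then obtain k where "- Q / E < k" "k < P / B" using dense by blast
        with True E have "P - k * B > 0" "Q + k * E > 0" by (auto simp: field_simps)
        then show ?thesis by blast
      next
        case False
        with 3 have E: "E < 0" "B < 0" by (auto simp: zero_less_mult_iff)
        then have "cross l w * c0 < 0" using 0 w by (metis add_neg_neg mult_neg_pos)
        with c have "cross l w * c1 < 0" by (auto simp: zero_less_mult_iff mult_less_0_iff)
        then have "P / B < - Q / E" using 1 E by (simp add: field_simps)
        then obtain k where "P / B < k" "k < - Q / E" using dense by blast
        with E have "P - k * B > 0" "Q + k * E > 0" by (auto simp: field_simps)
        then show ?thesis by blast
      qed
    qed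
  qed
  then show thesis using that eqs by auto
qed

text \<open>In general the area is quadratic in \<open>t\<close>; the quadratic term is a cross
  product of two multiples of \<open>l\<close> and vanishes.\<close>

lemma ccw_unidirectional:
  assumes "x' = x + k1 *\<^sub>R l" "y' = y + k2 *\<^sub>R l" "z' = z + k3 *\<^sub>R l"
  shows "ccw (linepath x x' t) (linepath y y' t) (linepath z z' t) = (1 - t) * ccw x y z + t * ccw x' y' z'"
  unfolding assms by (simp add: ccw_def linepath_def algebra_simps)

lemma unidirectionalI:
  assumes "\<And>v. v \<in> vertices G \<Longrightarrow> \<exists>k::real. \<Delta> v = \<Gamma> v + k *\<^sub>R l"
  shows "unidirectional G \<Gamma> \<Delta>"
proof (cases "l = 0")
  case True
  \<comment> \<open>Nothing moves, and 1 is an arbitrary unit direction. This covers the case of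
    \<open>move_only_p\<close> in which \<open>p\<close> stays put.\<close>
  then show ?thesis
    unfolding unidirectional_def using assms by (intro exI[of _ 1]) (auto intro!: exI[of _ 0])
next
  case False
  show ?thesis
    unfolding unidirectional_def
  proof (intro exI[of _ "sgn l"] conjI ballI)
    fix v assume "v \<in> vertices G"
    then obtain k where "\<Delta> v = \<Gamma> v + k *\<^sub>R l" using assms by blast
    with False show "\<exists>k. \<Delta> v = \<Gamma> v + k *\<^sub>R sgn l"
      by (intro exI[of _ "k * norm l"]) (simp add: sgn_div_norm)
  qed (use False in \<open>simp add: norm_sgn\<close>)
qed

context triangulation
begin

lemma oriented_cong:
  assumes "\<And>v. v \<in> V \<Longrightarrow> \<Gamma> v = \<Delta> v"
  shows "oriented G \<Gamma> \<longleftrightarrow> oriented G \<Delta>"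
proof -
  have "ccw (\<Gamma> v) (\<Gamma> u) (\<Gamma> (third u v)) = ccw (\<Delta> v) (\<Delta> u) (\<Delta> (third u v))" if "(u, v) \<in> D" for u v
    using dart_vertices[OF that] dart_vertices[OF face_triangle(1)[OF that]] assms by simp
  then show ?thesis unfolding oriented_def by (intro ball_cong) auto
qed

lemma planar_drawing_cong:
  assumes "\<And>v. v \<in> V \<Longrightarrow> \<Gamma> v = \<Delta> v"
  shows "planar_drawing G \<Gamma> \<longleftrightarrow> planar_drawing G \<Delta>"
  unfolding planar_iff_oriented using assms by (rule oriented_cong)

lemma planar_linear_morph_cong:
  assumes "\<And>v. v \<in> V \<Longrightarrow> \<Gamma> v = \<Gamma>' v" "\<And>v. v \<in> V \<Longrightarrow> \<Delta> v = \<Delta>' v"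
  shows "planar_linear_morph G \<Gamma> \<Delta> \<longleftrightarrow> planar_linear_morph G \<Gamma>' \<Delta>'"
  unfolding planar_linear_morph_def
  by (intro ball_cong refl planar_drawing_cong) (simp add: linear_morph_def assms)

end

section \<open>The combinatorics of a contraction\<close>

locale contracted = triangulation G for G :: "'v embedded_graph" +
  fixes p a :: 'v
  assumes p_inner: "p \<notin> boundary G"
    and ap: "(a, p) \<in> darts G"
    and triangulated': "triangulated_planar_graph (contract G p a)"
begin

abbreviation G' :: "'v embedded_graph" where "G' \<equiv> contract G p a"

sublocale contraction: triangulation G'
  by unfold_locales (rule triangulated')

abbreviation N :: "'v set" where "N \<equiv> neighbours G p"
text \<open>\<open>b\<close> and \<open>e\<close> complete the faces to the right of
  \<open>(a, p)\<close> and \<open>(p, a)\<close>. Around \<open>p\<close> the order is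
  \<open>e\<close>, \<open>a\<close>, \<open>b\<close>.\<close>

abbreviation b :: 'v where "b \<equiv> rot G p a"
abbreviation e :: 'v where "e \<equiv> rot G a p"

lemma vertices': "vertices G' = V - {p}"
  by (simp add: contract_def)

lemma darts': "darts G' = {(u, v) \<in> D. u \<noteq> p \<and> v \<noteq> p} \<union> {a} \<times> (N - {a}) \<union> (N - {a}) \<times> {a}"
  by (simp add: contract_def)

lemma rot_contract:
  "rot G' v u =
     (if v = a then (if u \<in> N \<and> rot G p u \<noteq> a then rot G p u else rot G a u)
      else if u = a \<and> v \<in> N \<and> (v \<notin> neighbours G a \<or> rot G v a = p) then rot G v p
      else if rot G v u = p then a else rot G v u)"
  by (simp only: contract_def embedded_graph.simps)

lemma outer_face': "outer_face G' = outer_face G"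
  by (simp add: contract_def)

lemma p_vertex: "p \<in> V" and a_vertex: "a \<in> V" and ap_neq: "a \<noteq> p" "p \<noteq> a"
  using dart_vertices[OF ap] dart_irrefl[OF ap] by auto

lemma p_face_inner:
  assumes "(u, v) \<in> D" "p \<in> {u, v, third u v}" shows "(u, v) \<notin> outer_face G"
proof
  assume uv: "(u, v) \<in> outer_face G"
  have "{u, v, third u v} \<subseteq> boundary G"
    unfolding boundary_def outer_face_eq[OF uv] by auto
  with assms(2) p_inner show False by blast
qed

lemmas b_facts = face_triangle[OF ap]
lemmas e_facts = face_triangle[OF dart_sym[OF ap]]

text \<open>By \<open>card_darts\<close>, losing one vertex costs six darts. The contraction loses
  two for the edge \<open>a p\<close> and two for every common neighbour, so there are exactly two
  of these.\<close>

lemma common_neighbours: "N \<inter> neighbours G a = {b, e}" "b \<noteq> e"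
proof -
  let ?C = "N \<inter> neighbours G a"
  let ?D0 = "{(u, v) \<in> D. u \<noteq> p \<and> v \<noteq> p}"
  have fin: "finite N" by (rule finite_neighbours)
  have a_N: "a \<in> N" using ap by (simp add: neighbours_iff)
  have p_N: "p \<notin> N" using dart_irrefl by (auto simp: neighbours_iff)
  have "finite ?D0" by (rule finite_subset[OF _ finite_D]) auto
  have "D = ?D0 \<union> ({p} \<times> N \<union> N \<times> {p})"
    using dart_sym by (auto simp: neighbours_iff)
  also have "card \<dots> = card ?D0 + (card N + card N)"
    using \<open>finite ?D0\<close> fin p_N
    by (subst card_Un_disjoint, simp, simp, force, subst card_Un_disjoint)
       (auto simp: card_cartesian_product)
  finally have 1: "card D = card ?D0 + 2 * card N" by simp
  let ?M = "N - {a} - ?C"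
  have "darts G' = ?D0 \<union> ({a} \<times> ?M \<union> ?M \<times> {a})"
    unfolding darts' using dart_sym ap_neq p_N by (auto simp: neighbours_iff)
  also have "card \<dots> = card ?D0 + (card ?M + card ?M)"
    using \<open>finite ?D0\<close> fin
    by (subst card_Un_disjoint, simp, simp, force simp: neighbours_iff intro: dart_sym, subst card_Un_disjoint)
       (auto simp: card_cartesian_product)
  finally have 2: "card (darts G') = card ?D0 + 2 * card ?M" by simp
  have "a \<notin> ?C" using dart_irrefl by (auto simp: neighbours_iff)
  then have sub_N: "?C \<subseteq> N - {a}" by auto
  have "card N = card (N - {a}) + 1" using card.remove[OF fin a_N] by simp
  moreover have "card ?M = card (N - {a}) - card ?C"
    using fin sub_N by (intro card_Diff_subset) auto
  moreover have "card ?C \<le> card (N - {a})"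
    using fin sub_N by (intro card_mono) auto
  moreover have "card V = card (V - {p}) + 1"
    using finite_V p_vertex card.remove by fastforce
  ultimately have card_C: "card ?C = 2"
    using 1 2 card_darts contraction.card_darts unfolding vertices' by linarith
  have sub: "{b, e} \<subseteq> ?C"
    using b_facts(1,2) e_facts(1,2) dart_sym by (auto simp: neighbours_iff)
  show be: "b \<noteq> e"
  proof
    \<comment> \<open>The rotation at \<open>p\<close> would then alternate between \<open>a\<close>
      and \<open>b\<close>, leaving at most one common neighbour.\<close>
    assume be: "b = e"
    have "x \<in> {a, b}" if "(x, p) \<in> D" for x
    proof (rule rot_induct[OF ap _ _ that])
      show "rot G p x \<in> {a, b}" if "x \<in> {a, b}" for x
        using that e_facts(4) be by auto
    qed simp
    then have "?C \<subseteq> {b}" using dart_irrefl[of a a] by (auto simp: neighbours_iff) blast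
    then have "card ?C \<le> 1" using card_mono[of "{b}" ?C] by simp
    with card_C show False by simp
  qed
  show "?C = {b, e}"
    using card_subset_eq[OF _ sub] card_C be fin by simp
qed

text \<open>The delicate case is a dart from a neighbour of \<open>p\<close> to \<open>a\<close>. It
  starts at \<open>b\<close> or \<open>e\<close>; from \<open>b\<close> its face contains
  \<open>p\<close>, and for \<open>e\<close> the rotation at \<open>p\<close> yields
  \<open>a\<close>, so the old rotation at \<open>a\<close> is used.\<close>

lemma rot_unchanged:
  assumes "(u, v) \<in> D" "p \<notin> {u, v, third u v}"
  shows "(u, v) \<in> darts G'" "rot G' v u = rot G v u"
proof -
  show "(u, v) \<in> darts G'" using assms by (auto simp: darts')
  have "rot G p u = a" if "v = a" "u \<in> N"
  proof -
    have "u \<in> N \<inter> neighbours G a"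
      using that assms(1) by (simp add: neighbours_iff)
    then have "u \<in> {b, e}" unfolding common_neighbours(1) .
    moreover have "u \<noteq> b" using assms(2) that(1) b_facts(4) by auto
    ultimately show ?thesis using e_facts(4) by simp
  qed
  moreover have "v \<in> neighbours G a" "rot G v a \<noteq> p" if "u = a"
    using assms that by (auto simp: neighbours_def)
  ultimately show "rot G' v u = rot G v u"
    using assms(2) by (cases "v = a") (auto simp: rot_contract)
qed

text \<open>A face at \<open>p\<close> that avoids \<open>a\<close> becomes a face at
  \<open>a\<close>. It stays inner: it keeps the dart opposite to \<open>p\<close>, and the outer
  face is untouched.\<close>

lemma link_dart:
  assumes "(u, p) \<in> D" "u \<noteq> a" "rot G p u \<noteq> a"
  shows "(u, a) \<in> darts G'" "rot G' a u = rot G p u" "(u, a) \<notin> outer_face G'"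
proof -
  note t = face_triangle[OF assms(1)]
  show ua: "(u, a) \<in> darts G'" using assms by (simp add: darts' neighbours_iff)
  show rot: "rot G' a u = rot G p u" using assms by (simp add: contract_def neighbours_iff)
  show "(u, a) \<notin> outer_face G'"
  proof
    assume "(u, a) \<in> outer_face G'"
    then have "(rot G p u, u) \<in> outer_face G"
      using contraction.outer_face_eq[of u a] unfolding rot outer_face' by blast
    then show False using p_face_inner[OF t(2)] t(4) by auto
  qed
qed

lemma oriented_at_p:
  assumes "oriented G \<Gamma>" "(u, p) \<in> D"
  shows "ccw (\<Gamma> p) (\<Gamma> u) (\<Gamma> (rot G p u)) > 0"
  using assms p_face_inner[OF assms(2)] by (auto simp: oriented_def split: if_splits)

text \<open>A face avoiding \<open>p\<close> is also a face of \<open>G'\<close>. Any other face is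
  inner and, after rotating its corners, is given by a dart ending at \<open>p\<close>.\<close>

lemma orientedI:
  assumes or': "oriented G' \<Gamma>" and at_p: "\<And>u. (u, p) \<in> D \<Longrightarrow> ccw (\<Gamma> p) (\<Gamma> u) (\<Gamma> (rot G p u)) > 0"
  shows "oriented G \<Gamma>"
  unfolding oriented_def
proof clarify
  fix u v assume uv: "(u, v) \<in> D"
  let ?w = "third u v"
  note t = face_triangle[OF uv]
  show "if (u, v) \<in> outer_face G then ccw (\<Gamma> v) (\<Gamma> u) (\<Gamma> ?w) < 0 else 0 < ccw (\<Gamma> v) (\<Gamma> u) (\<Gamma> ?w)"
  proof (cases "p \<in> {u, v, ?w}")
    case True
    then consider "v = p" | "u = p" | "?w = p" by blast
    then have "ccw (\<Gamma> v) (\<Gamma> u) (\<Gamma> ?w) > 0"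
    proof cases
      case 1
      then show ?thesis using at_p uv by simp
    next
      case 2
      then show ?thesis using at_p[of ?w] t(2,4) ccw_rotate[of "\<Gamma> v" "\<Gamma> p"] by simp
    next
      case 3
      then show ?thesis using at_p[of v] t(1,3) ccw_rotate[of "\<Gamma> p" "\<Gamma> v"] by simp
    qed
    then show ?thesis using p_face_inner[OF uv True] by simp
  next
    case False
    then show ?thesis
      using bspec[OF or'[unfolded oriented_def] rot_unchanged(1)[OF uv False]]
      by (simp add: outer_face' rot_unchanged(2)[OF uv False] split: if_splits)
  qed
qed

end

subsection \<open>Lifting morphs of the reduced graph\<close>

text \<open>The ends agree only on vertices, as a drawing of the reduced graph has an arbitrary
  value at \<open>p\<close>.\<close>

definition morphs :: "'v embedded_graph \<Rightarrow> nat \<Rightarrow> 'v drawing \<Rightarrow> 'v drawing \<Rightarrow> bool" where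
  "morphs G k \<Gamma> \<Gamma>' \<longleftrightarrow>
     (\<exists>\<Delta> :: nat \<Rightarrow> 'v drawing.
        (\<forall>v\<in>vertices G. \<Delta> 0 v = \<Gamma> v) \<and> (\<forall>v\<in>vertices G. \<Delta> k v = \<Gamma>' v) \<and>
        (\<forall>j\<le>k. planar_drawing G (\<Delta> j)) \<and>
        (\<forall>j<k. unidirectional G (\<Delta> j) (\<Delta> (Suc j)) \<and> planar_linear_morph G (\<Delta> j) (\<Delta> (Suc j))))"

lemma linear_morph_0_1: "linear_morph \<Gamma> \<Delta> 0 = \<Gamma>" "linear_morph \<Gamma> \<Delta> 1 = \<Delta>"
  by (simp_all add: linear_morph_def linepath_def)

lemma planar_linear_morph_ends:
  assumes "planar_linear_morph G \<Gamma> \<Delta>" shows "planar_drawing G \<Gamma>" "planar_drawing G \<Delta>"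
  using assms[unfolded planar_linear_morph_def, THEN bspec, of 0]
    assms[unfolded planar_linear_morph_def, THEN bspec, of 1] by (simp_all add: linear_morph_0_1)

lemma morphs_step:
  assumes "unidirectional G \<Gamma> \<Delta>" "planar_linear_morph G \<Gamma> \<Delta>"
  shows "morphs G 1 \<Gamma> \<Delta>"
  unfolding morphs_def
  by (rule exI[of _ "\<lambda>j. if j = 0 then \<Gamma> else \<Delta>"])
     (use assms planar_linear_morph_ends[OF assms(2)] in auto)

context triangulation
begin

lemma morphs_refl:
  assumes "planar_drawing G \<Gamma>" "\<And>v. v \<in> V \<Longrightarrow> \<Gamma> v = \<Gamma>' v"
  shows "morphs G 0 \<Gamma> \<Gamma>'"
  unfolding morphs_def using assms by (intro exI[of _ "\<lambda>_. \<Gamma>"]) auto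

lemma unidirectional_cong:
  assumes "\<And>v. v \<in> V \<Longrightarrow> \<Delta> v = \<Delta>' v"
  shows "unidirectional G \<Gamma> \<Delta> \<longleftrightarrow> unidirectional G \<Gamma> \<Delta>'"
  unfolding unidirectional_def by (simp add: assms cong: ball_cong)

lemma morphs_trans:
  assumes "morphs G m \<Gamma>\<^sub>1 \<Gamma>\<^sub>2" "morphs G n \<Gamma>\<^sub>2 \<Gamma>\<^sub>3"
  shows "morphs G (m + n) \<Gamma>\<^sub>1 \<Gamma>\<^sub>3"
proof -
  obtain A where A: "\<And>v. v \<in> V \<Longrightarrow> A 0 v = \<Gamma>\<^sub>1 v" "\<And>v. v \<in> V \<Longrightarrow> A m v = \<Gamma>\<^sub>2 v"
    "\<And>j. j \<le> m \<Longrightarrow> planar_drawing G (A j)"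
    "\<And>j. j < m \<Longrightarrow> unidirectional G (A j) (A (Suc j)) \<and> planar_linear_morph G (A j) (A (Suc j))"
    using assms(1) unfolding morphs_def by blast
  obtain B where B: "\<And>v. v \<in> V \<Longrightarrow> B 0 v = \<Gamma>\<^sub>2 v" "\<And>v. v \<in> V \<Longrightarrow> B n v = \<Gamma>\<^sub>3 v"
    "\<And>j. j \<le> n \<Longrightarrow> planar_drawing G (B j)"
    "\<And>j. j < n \<Longrightarrow> unidirectional G (B j) (B (Suc j)) \<and> planar_linear_morph G (B j) (B (Suc j))"
    using assms(2) unfolding morphs_def by blast
  have AB: "A m v = B 0 v" if "v \<in> V" for v using A(2) B(1) that by simp
  let ?C = "\<lambda>j. if j < m then A j else B (j - m)"
  show ?thesis
    unfolding morphs_def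
  proof (intro exI[of _ ?C] conjI ballI allI impI)
    fix v assume v: "v \<in> V"
    show "?C 0 v = \<Gamma>\<^sub>1 v" using A(1)[OF v] AB[OF v] by (cases "m = 0") auto
    show "?C (m + n) v = \<Gamma>\<^sub>3 v" using B(2)[OF v] by simp
  next
    fix j assume "j \<le> m + n"
    then show "planar_drawing G (?C j)" using A(3) B(3) by auto
  next
    fix j assume j: "j < m + n"
    consider "Suc j < m" | "Suc j = m" | "m \<le> j" by linarith
    then have "unidirectional G (?C j) (?C (Suc j)) \<and> planar_linear_morph G (?C j) (?C (Suc j))"
    proof cases
      \<comment> \<open>The seam: index \<open>m\<close> already takes \<open>B 0\<close>, which
        agrees with \<open>A m\<close> on the vertices only.\<close>
      case 2
      have "unidirectional G (A j) (A m) \<longleftrightarrow> unidirectional G (A j) (B 0)"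
        "planar_linear_morph G (A j) (A m) \<longleftrightarrow> planar_linear_morph G (A j) (B 0)"
        using AB by (auto intro!: unidirectional_cong planar_linear_morph_cong)
      then show ?thesis using A(4)[of j] 2 by auto
    qed (use A(4) B(4)[of "j - m"] j in \<open>auto simp: Suc_diff_le\<close>)
    then show "unidirectional G (?C j) (?C (Suc j))" "planar_linear_morph G (?C j) (?C (Suc j))" by auto
  qed
qed

end

section \<open>Placing the contracted vertex near its target\<close>

context contracted
begin

text \<open>For \<open>p\<close> at \<open>\<Gamma> a + w\<close>, these are the positivity
  conditions of the two faces containing both \<open>p\<close> and \<open>a\<close>.\<close>

definition cone :: "'v drawing \<Rightarrow> complex set" where
  "cone \<Gamma> = {w. cross (\<Gamma> b - \<Gamma> a) w > 0 \<and> cross w (\<Gamma> e - \<Gamma> a) > 0}"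

lemma rot_p_eq_a: assumes "(u, p) \<in> D" "rot G p u = a" shows "u = e"
  using face_triangle(3,4)[OF assms(1)] assms(2) e_facts by metis

lemma initial_in_cone:
  assumes "oriented G \<Gamma>" shows "\<Gamma> p - \<Gamma> a \<in> cone \<Gamma>"
  using oriented_at_p[OF assms ap] oriented_at_p[OF assms e_facts(2)]
    e_facts(4) ccw_rotate[of "\<Gamma> p" "\<Gamma> a" "\<Gamma> b"] ccw_rotate[of "\<Gamma> p" "\<Gamma> e" "\<Gamma> a"]
    ccw_rotate[of "\<Gamma> e" "\<Gamma> a" "\<Gamma> p"]
  by (simp add: cone_def ccw_cross)

text \<open>The two faces at the edge \<open>a p\<close> are positive for every positive distance by
  the choice of \<open>w\<close>. The other faces at \<open>p\<close> converge to positive faces of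
  the reduced graph, so a small distance suffices.\<close>

lemma oriented_near_a:
  assumes or': "oriented G' \<Gamma>" and w: "w \<in> cone \<Gamma>"
  shows "\<forall>\<^sub>F \<delta> in at_right (0::real). oriented G (\<Gamma>(p := \<Gamma> a + \<delta> *\<^sub>R w))"
proof -
  let ?q = "\<lambda>\<delta>::real. \<Gamma> a + \<delta> *\<^sub>R w"
  have "\<forall>\<^sub>F \<delta> in at_right 0. \<forall>u\<in>N. ccw (?q \<delta>) (\<Gamma> u) (\<Gamma> (rot G p u)) > 0"
  proof (rule eventually_ball_finite[OF finite_neighbours], rule ballI)
    fix u assume "u \<in> N"
    then have u: "(u, p) \<in> D" by (simp add: neighbours_iff)
    have pos: "\<forall>\<^sub>F \<delta> in at_right (0::real). 0 < \<delta>" by (simp add: eventually_at_right_less)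
    consider "u = a" | "rot G p u = a" | "u \<noteq> a" "rot G p u \<noteq> a" by blast
    then show "\<forall>\<^sub>F \<delta> in at_right 0. ccw (?q \<delta>) (\<Gamma> u) (\<Gamma> (rot G p u)) > 0"
    proof cases
      case 1
      have "ccw (?q \<delta>) (\<Gamma> a) (\<Gamma> b) = \<delta> * cross (\<Gamma> b - \<Gamma> a) w" for \<delta>
        by (simp add: ccw_def cross_def algebra_simps)
      then show ?thesis using pos w 1 by (auto simp: cone_def elim!: eventually_mono)
    next
      case 2
      then have "u = e" using rot_p_eq_a u by blast
      have "ccw (?q \<delta>) (\<Gamma> e) (\<Gamma> a) = \<delta> * cross w (\<Gamma> e - \<Gamma> a)" for \<delta>
        by (simp add: ccw_def cross_def algebra_simps)
      then show ?thesis using pos w 2 \<open>u = e\<close> by (auto simp: cone_def elim!: eventually_mono)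
    next
      case 3
      have "ccw (\<Gamma> a) (\<Gamma> u) (\<Gamma> (rot G p u)) > 0"
        using bspec[OF or'[unfolded oriented_def] link_dart(1)[OF u 3]] link_dart(2,3)[OF u 3]
        by (simp split: if_splits)
      moreover have "((\<lambda>\<delta>. ccw (?q \<delta>) (\<Gamma> u) (\<Gamma> (rot G p u))) \<longlongrightarrow> ccw (?q 0) (\<Gamma> u) (\<Gamma> (rot G p u))) (at_right 0)"
        by (intro tendsto_intros)
      ultimately show ?thesis by (auto dest: order_tendstoD(1)[where a = 0])
    qed
  qed
  then show ?thesis
  proof eventually_elim
    case (elim \<delta>)
    have p_N: "u \<noteq> p \<and> rot G p u \<noteq> p" if "(u, p) \<in> D" for u
      using face_triangle(5-7)[OF that] by auto
    show ?case
    proof (rule orientedI)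
      show "oriented G' (\<Gamma>(p := ?q \<delta>))"
        using or' contraction.oriented_cong[of "\<Gamma>(p := ?q \<delta>)" \<Gamma>] by (auto simp: vertices')
    qed (use elim p_N in \<open>auto simp: neighbours_iff\<close>)
  qed
qed

text \<open>If the rays from \<open>a\<close> coincided, one of \<open>b\<close> and
  \<open>e\<close> would lie on the edge from \<open>a\<close> to the other. This provides the
  premises of \<open>cone_transfer\<close>.\<close>

lemma planar_rays:
  assumes "planar_drawing G' \<Gamma>"
  shows "\<Gamma> b - \<Gamma> a \<noteq> 0" "\<Gamma> e - \<Gamma> a \<noteq> 0" "c > 0 \<Longrightarrow> \<Gamma> e - \<Gamma> a \<noteq> c *\<^sub>R (\<Gamma> b - \<Gamma> a)"
proof -
  have ver: "a \<in> vertices G'" "b \<in> vertices G'" "e \<in> vertices G'"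
    using a_vertex ap_neq b_facts e_facts dart_vertices[OF b_facts(2)] dart_vertices[OF e_facts(1)]
    by (auto simp: vertices')
  have darts: "(a, b) \<in> darts G'" "(a, e) \<in> darts G'"
    using b_facts(2,5-7) e_facts(1,5-7) dart_sym[OF b_facts(2)] by (auto simp: darts')
  show "\<Gamma> b - \<Gamma> a \<noteq> 0" and "\<Gamma> e - \<Gamma> a \<noteq> 0"
    using contraction.drawing_inj[OF assms] ver b_facts(6) e_facts(7) by auto
  show "\<Gamma> e - \<Gamma> a \<noteq> c *\<^sub>R (\<Gamma> b - \<Gamma> a)" if c: "c > 0"
  proof
    assume eq: "\<Gamma> e - \<Gamma> a = c *\<^sub>R (\<Gamma> b - \<Gamma> a)"
    show False
    proof (cases "c \<le> 1")
      case True
      have "\<Gamma> e = (1 - c) *\<^sub>R \<Gamma> a + c *\<^sub>R \<Gamma> b"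
        using eq by (simp add: algebra_simps)
      then have "\<Gamma> e \<in> closed_segment (\<Gamma> a) (\<Gamma> b)"
        unfolding in_segment using True c by (intro exI[of _ c]) simp
      then have "e \<in> {a, b}"
        by (rule contraction.vertex_not_on_edge[OF assms darts(1) ver(3)])
      then show False using common_neighbours(2) e_facts(7) by auto
    next
      case False
      have "(1 / c) *\<^sub>R (\<Gamma> e - \<Gamma> a) = \<Gamma> b - \<Gamma> a"
        using eq c by simp
      then have "\<Gamma> b = (1 - 1 / c) *\<^sub>R \<Gamma> a + (1 / c) *\<^sub>R \<Gamma> e"
        by (simp add: algebra_simps)
      then have "\<Gamma> b \<in> closed_segment (\<Gamma> a) (\<Gamma> e)"
        unfolding in_segment using False by (intro exI[of _ "1 / c"]) simp
      then have "b \<in> {a, e}"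
        by (rule contraction.vertex_not_on_edge[OF assms darts(2) ver(2)])
      then show False using common_neighbours(2) b_facts(6) by auto
    qed
  qed
qed

lemma cone_step:
  assumes "planar_linear_morph G' \<Gamma> \<Delta>" "unidirectional G' \<Gamma> \<Delta>" "w \<in> cone \<Gamma>"
  obtains w' l k where "w' \<in> cone \<Delta>" "w' = w + k *\<^sub>R l"
    "\<And>v. v \<in> vertices G' \<Longrightarrow> \<exists>k::real. \<Delta> v = \<Gamma> v + k *\<^sub>R l"
proof -
  obtain l where l: "norm l = 1" "\<And>v. v \<in> vertices G' \<Longrightarrow> \<exists>k::real. \<Delta> v = \<Gamma> v + k *\<^sub>R l"
    using assms(2) unfolding unidirectional_def by blast
  have ver: "a \<in> vertices G'" "b \<in> vertices G'" "e \<in> vertices G'"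
    using a_vertex ap_neq b_facts e_facts dart_vertices[OF b_facts(2)] dart_vertices[OF e_facts(1)]
    by (auto simp: vertices')
  obtain ka kb ke where k: "\<Delta> a = \<Gamma> a + ka *\<^sub>R l" "\<Delta> b = \<Gamma> b + kb *\<^sub>R l" "\<Delta> e = \<Gamma> e + ke *\<^sub>R l"
    using l(2)[OF ver(1)] l(2)[OF ver(2)] l(2)[OF ver(3)] by blast
  \<comment> \<open>Seen from the moving vertex \<open>a\<close>, the neighbours \<open>b\<close>
    and \<open>e\<close> still move along \<open>l\<close>.\<close>
  have at_t: "linear_morph \<Gamma> \<Delta> t b - linear_morph \<Gamma> \<Delta> t a = (\<Gamma> b - \<Gamma> a) + (t * (kb - ka)) *\<^sub>R l"
    "linear_morph \<Gamma> \<Delta> t e - linear_morph \<Gamma> \<Delta> t a = (\<Gamma> e - \<Gamma> a) + (t * (ke - ka)) *\<^sub>R l" for t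
    by (simp_all add: linear_morph_def linepath_def k algebra_simps)
  have planar: "planar_drawing G' (linear_morph \<Gamma> \<Delta> t)" if "t \<in> {0..1}" for t
    using assms(1) that unfolding planar_linear_morph_def by blast
  obtain \<kappa> where "cross (\<Delta> b - \<Delta> a) (w + \<kappa> *\<^sub>R l) > 0" "cross (w + \<kappa> *\<^sub>R l) (\<Delta> e - \<Delta> a) > 0"
  proof (rule cone_transfer[of l "\<Delta> b - \<Delta> a" "\<Gamma> b - \<Gamma> a" "kb - ka" "\<Delta> e - \<Delta> a" "\<Gamma> e - \<Gamma> a" "ke - ka" w])
    show "l \<noteq> 0" using l(1) by auto
    show "\<Delta> b - \<Delta> a = \<Gamma> b - \<Gamma> a + (kb - ka) *\<^sub>R l" "\<Delta> e - \<Delta> a = \<Gamma> e - \<Gamma> a + (ke - ka) *\<^sub>R l"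
      by (simp_all add: k algebra_simps)
    show "cross (\<Gamma> b - \<Gamma> a) w > 0" "cross w (\<Gamma> e - \<Gamma> a) > 0"
      using assms(3) by (auto simp: cone_def)
  qed (use planar_rays[OF planar] in \<open>auto simp: at_t\<close>)
  then have "w + \<kappa> *\<^sub>R l \<in> cone \<Delta>" by (simp add: cone_def)
  with l(2) show thesis using that by blast
qed

text \<open>Faces at \<open>p\<close> have areas that are affine in time and positive at both ends;
  all other faces are controlled by the planar morph of the reduced graph.\<close>

lemma lift_morph:
  assumes "oriented G \<Gamma>" "oriented G \<Delta>" "planar_linear_morph G' \<Gamma> \<Delta>"
    and "\<And>v. v \<in> V \<Longrightarrow> \<exists>k::real. \<Delta> v = \<Gamma> v + k *\<^sub>R l"
  shows "planar_linear_morph G \<Gamma> \<Delta>"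
  unfolding planar_linear_morph_def planar_iff_oriented
proof
  fix t :: real assume t: "t \<in> {0..1}"
  show "oriented G (linear_morph \<Gamma> \<Delta> t)"
  proof (rule orientedI)
    show "oriented G' (linear_morph \<Gamma> \<Delta> t)"
      using assms(3) t unfolding planar_linear_morph_def contraction.planar_iff_oriented by blast
    fix u assume u: "(u, p) \<in> D"
    let ?w = "rot G p u"
    have "u \<in> V" "?w \<in> V" using dart_vertices[OF u] dart_vertices[OF face_triangle(1)[OF u]] by auto
    then obtain k1 k2 k3 where "\<Delta> p = \<Gamma> p + k1 *\<^sub>R l" "\<Delta> u = \<Gamma> u + k2 *\<^sub>R l" "\<Delta> ?w = \<Gamma> ?w + k3 *\<^sub>R l"
      using assms(4) p_vertex by metis
    then have "ccw (linear_morph \<Gamma> \<Delta> t p) (linear_morph \<Gamma> \<Delta> t u) (linear_morph \<Gamma> \<Delta> t ?w) =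
        (1 - t) * ccw (\<Gamma> p) (\<Gamma> u) (\<Gamma> ?w) + t * ccw (\<Delta> p) (\<Delta> u) (\<Delta> ?w)"
      unfolding linear_morph_def by (rule ccw_unidirectional)
    moreover have "\<dots> > 0"
    proof (cases "t = 0")
      case False
      with t oriented_at_p[OF assms(1) u] oriented_at_p[OF assms(2) u] show ?thesis
        by (intro add_nonneg_pos mult_nonneg_nonneg mult_pos_pos) auto
    qed (use oriented_at_p[OF assms(1) u] in simp)
    ultimately show "ccw (linear_morph \<Gamma> \<Delta> t p) (linear_morph \<Gamma> \<Delta> t u) (linear_morph \<Gamma> \<Delta> t ?w) > 0"
      by simp
  qed
qed

text \<open>The reduced drawing stands still and the displacement of \<open>p\<close> is the common
  direction, so only the two end drawings need checking.\<close>

lemma move_only_p: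
  assumes "planar_drawing G \<Gamma>" "planar_drawing G \<Delta>" "planar_drawing G' \<Gamma>"
    and same: "\<And>v. v \<in> V - {p} \<Longrightarrow> \<Delta> v = \<Gamma> v"
  shows "morphs G 1 \<Gamma> \<Delta>"
proof (rule morphs_step)
  have *: "\<exists>k::real. \<Delta> v = \<Gamma> v + k *\<^sub>R (\<Delta> p - \<Gamma> p)" if "v \<in> V" for v
  proof (cases "v = p")
    case False
    with that same[of v] show ?thesis by (intro exI[of _ 0]) simp
  qed (auto intro!: exI[of _ 1])
  then show "unidirectional G \<Gamma> \<Delta>" by (rule unidirectionalI)
  have "planar_drawing G' (linear_morph \<Gamma> \<Delta> t)" for t
    using assms(3) contraction.planar_drawing_cong[of "linear_morph \<Gamma> \<Delta> t" \<Gamma>] same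
    by (auto simp: vertices' linear_morph_def linepath_def simp flip: scaleR_add_left)
  then have "planar_linear_morph G' \<Gamma> \<Delta>" by (simp add: planar_linear_morph_def)
  then show "planar_linear_morph G \<Gamma> \<Delta>"
    using lift_morph[OF _ _ _ *] assms(1,2) by (simp add: planar_iff_oriented)
qed

lemma lift_morphs:
  assumes "planar_drawing G \<Gamma>" "planar_drawing G \<Gamma>'" "planar_drawing G' \<Gamma>" "planar_drawing G' \<Gamma>'"
    and "morphs G' n \<Gamma> \<Gamma>'"
  shows "morphs G (n + 2) \<Gamma> \<Gamma>'"
proof -
  obtain \<Delta> where \<Delta>0: "\<And>v. v \<in> V - {p} \<Longrightarrow> \<Delta> 0 v = \<Gamma> v" and \<Delta>n: "\<And>v. v \<in> V - {p} \<Longrightarrow> \<Delta> n v = \<Gamma>' v"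
    and planar: "\<And>j. j \<le> n \<Longrightarrow> planar_drawing G' (\<Delta> j)"
    and step: "\<And>j. j < n \<Longrightarrow> unidirectional G' (\<Delta> j) (\<Delta> (Suc j)) \<and> planar_linear_morph G' (\<Delta> j) (\<Delta> (Suc j))"
    using assms(5) unfolding morphs_def vertices' by blast
  have ver: "a \<in> V - {p}" "b \<in> V - {p}" "e \<in> V - {p}"
    using a_vertex ap_neq b_facts e_facts dart_vertices[OF b_facts(2)] dart_vertices[OF e_facts(1)] by auto
  \<comment> \<open>The true position of \<open>p\<close> shows that the first cone is nonempty;
    each later direction comes from the previous one by \<open>cone_step\<close>.\<close>
  have "\<Gamma> p - \<Gamma> a \<in> cone (\<Delta> 0)"
    using initial_in_cone[of \<Gamma>] assms(1) \<Delta>0 ver by (simp add: planar_iff_oriented cone_def)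
  then have ex0: "\<exists>w. 0 \<le> n \<longrightarrow> w \<in> cone (\<Delta> 0)" by blast
  let ?Q = "\<lambda>j w w'. j < n \<longrightarrow> (\<exists>l. (\<exists>k::real. w' = w + k *\<^sub>R l) \<and>
    (\<forall>v\<in>vertices G'. \<exists>k::real. \<Delta> (Suc j) v = \<Delta> j v + k *\<^sub>R l))"
  have ex_step: "\<exists>w'. (Suc j \<le> n \<longrightarrow> w' \<in> cone (\<Delta> (Suc j))) \<and> ?Q j w w'"
    if "j \<le> n \<longrightarrow> w \<in> cone (\<Delta> j)" for j w
  proof (cases "j < n")
    case True
    with that have "w \<in> cone (\<Delta> j)" by simp
    then obtain w' l k where "w' \<in> cone (\<Delta> (Suc j))" "w' = w + k *\<^sub>R l"
      "\<And>v. v \<in> vertices G' \<Longrightarrow> \<exists>k::real. \<Delta> (Suc j) v = \<Delta> j v + k *\<^sub>R l"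
      by (rule cone_step[OF conjunct2[OF step[OF True]] conjunct1[OF step[OF True]]]) blast
    then show ?thesis by blast
  qed simp
  obtain w where w: "\<And>j. j \<le> n \<Longrightarrow> w j \<in> cone (\<Delta> j)" "\<And>j. ?Q j (w j) (w (Suc j))"
    using dependent_nat_choice[of "\<lambda>j w. j \<le> n \<longrightarrow> w \<in> cone (\<Delta> j)" ?Q, OF ex0 ex_step] by blast
  \<comment> \<open>One \<open>\<delta>\<close> for all stages. From stage \<open>j\<close> to the
    next, \<open>p\<close> shifts by the displacement of \<open>a\<close> plus
    \<open>\<delta>\<close> times the change of \<open>w\<close>, both multiples of the same
    \<open>l\<close>.\<close>
  define \<Theta> where "\<Theta> \<delta> j = (\<Delta> j)(p := \<Delta> j a + \<delta> *\<^sub>R w j)" for \<delta> j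
  have "\<forall>\<^sub>F \<delta> in at_right (0::real). \<forall>j\<in>{..n}. oriented G (\<Theta> \<delta> j)"
    unfolding \<Theta>_def using w(1) planar
    by (intro eventually_ball_finite ballI oriented_near_a) (auto simp: contraction.planar_iff_oriented)
  then obtain \<delta> where \<delta>: "\<And>j. j \<le> n \<Longrightarrow> planar_drawing G (\<Theta> \<delta> j)"
    using eventually_happens[of _ "at_right (0::real)"] by (fastforce simp: planar_iff_oriented)
  have same: "\<Theta> \<delta> j v = \<Delta> j v" if "v \<in> V - {p}" for j v
    using that by (simp add: \<Theta>_def)
  have "morphs G n (\<Theta> \<delta> 0) (\<Theta> \<delta> n)"
    unfolding morphs_def
  proof (intro exI[of _ "\<Theta> \<delta>"] conjI ballI allI impI)
    fix j assume j: "j < n"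
    obtain l k where l: "w (Suc j) = w j + k *\<^sub>R l"
      "\<And>v. v \<in> V - {p} \<Longrightarrow> \<exists>k::real. \<Delta> (Suc j) v = \<Delta> j v + k *\<^sub>R l"
      using w(2)[of j] j unfolding vertices' by blast
    have dir: "\<exists>k::real. \<Theta> \<delta> (Suc j) v = \<Theta> \<delta> j v + k *\<^sub>R l" if "v \<in> V" for v
    proof (cases "v = p")
      case True
      obtain ka where "\<Delta> (Suc j) a = \<Delta> j a + ka *\<^sub>R l" using l(2)[OF ver(1)] by blast
      then have "\<Theta> \<delta> (Suc j) p = \<Theta> \<delta> j p + (ka + \<delta> * k) *\<^sub>R l"
        using l(1) by (simp add: \<Theta>_def algebra_simps)
      then show ?thesis using True by blast
    next
      case False
      then show ?thesis using l(2)[of v] that by (simp add: same)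
    qed
    then show "unidirectional G (\<Theta> \<delta> j) (\<Theta> \<delta> (Suc j))" by (rule unidirectionalI)
    have "planar_linear_morph G' (\<Theta> \<delta> j) (\<Theta> \<delta> (Suc j))"
      using step[OF j] contraction.planar_linear_morph_cong[of "\<Theta> \<delta> j" "\<Delta> j" "\<Theta> \<delta> (Suc j)" "\<Delta> (Suc j)"]
      by (simp add: same vertices')
    then show "planar_linear_morph G (\<Theta> \<delta> j) (\<Theta> \<delta> (Suc j))"
      using lift_morph[OF _ _ _ dir] \<delta>[of j] \<delta>[of "Suc j"] j by (simp add: planar_iff_oriented)
  qed (use \<delta> in auto)
  moreover have "morphs G 1 \<Gamma> (\<Theta> \<delta> 0)"
    using move_only_p[OF assms(1) \<delta>[of 0] assms(3)] same \<Delta>0 by simp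
  moreover have "morphs G 1 (\<Theta> \<delta> n) \<Gamma>'"
  proof (rule move_only_p[OF \<delta>[of n] assms(2)])
    show "planar_drawing G' (\<Theta> \<delta> n)"
      using assms(4) contraction.planar_drawing_cong[of "\<Theta> \<delta> n" \<Gamma>'] same \<Delta>n by (simp add: vertices')
  qed (use same \<Delta>n in auto)
  ultimately have "morphs G (1 + n + 1) \<Gamma> \<Gamma>'"
    using morphs_trans by blast
  then show ?thesis by simp
qed

end

text \<open>The graph is generalized in the induction because the inner part of a detour lives on
  the contracted graph. The two steps added by \<open>lift_morphs\<close> match the contraction and
  the uncontraction.\<close>

lemma pseudo_morph_imp_morphs:
  assumes "triangulated_planar_graph G" "planar_drawing G \<Gamma>" "is_pseudo_morph M G \<Gamma> \<Gamma>'"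
    "unidirectional_steps M G \<Gamma>"
  shows "morphs G (steps M) \<Gamma> \<Gamma>'"
  using assms
proof (induction M arbitrary: G \<Gamma> \<Gamma>')
  case Stop
  then interpret triangulation G by unfold_locales
  show ?case using Stop.prems by (auto intro!: morphs_refl)
next
  case (Linear \<Delta> M)
  interpret triangulation G by unfold_locales (rule Linear.prems(1))
  have step: "planar_linear_morph G \<Gamma> \<Delta>" "unidirectional G \<Gamma> \<Delta>"
    using Linear.prems by auto
  have "morphs G 1 \<Gamma> \<Delta>" by (rule morphs_step[OF step(2,1)])
  moreover have "morphs G (steps M) \<Delta> \<Gamma>'"
    using Linear.prems planar_linear_morph_ends(2)[OF step(1)] by (intro Linear.IH) auto
  ultimately show ?case using morphs_trans[of 1 \<Gamma> \<Delta>] by simp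
next
  case (Detour p a N \<Delta> M)
  then have con: "contraction G \<Gamma> p a" "contraction G \<Delta> p a" by auto
  interpret contracted G p a
    using con(1) Detour.prems(1)
    by unfold_locales (auto simp: contraction_def triangulation.neighbours_iff[OF triangulation.intro])
  have "morphs G' (steps N) \<Gamma> \<Delta>"
    using Detour.prems con by (intro Detour.IH(1)) (auto simp: contraction_def)
  then have "morphs G (steps N + 2) \<Gamma> \<Delta>"
    using con by (intro lift_morphs) (auto simp: contraction_def)
  moreover have "morphs G (steps M) \<Delta> \<Gamma>'"
    using Detour.prems con by (intro Detour.IH(2)) (auto simp: contraction_def)
  ultimately show ?case using morphs_trans[of "steps N + 2" \<Gamma> \<Delta>] by (simp add: ac_simps)
qed

theorem lemma2:
  fixes G :: "'v embedded_graph" and \<Gamma>\<^sub>1 \<Gamma>\<^sub>2 :: "'v drawing"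
    and M :: "'v pseudo_morph" and k :: nat
  assumes "triangulated_planar_graph G"
    and "planar_drawing G \<Gamma>\<^sub>1" and "planar_drawing G \<Gamma>\<^sub>2"
    and "is_pseudo_morph M G \<Gamma>\<^sub>1 \<Gamma>\<^sub>2"
    and "unidirectional_steps M G \<Gamma>\<^sub>1"
    and "steps M = k"
    and "contracted_degrees_le 5 M G"
  shows "\<exists>\<Delta> :: nat \<Rightarrow> 'v drawing.
    (\<forall>v\<in>vertices G. \<Delta> 0 v = \<Gamma>\<^sub>1 v) \<and> (\<forall>v\<in>vertices G. \<Delta> k v = \<Gamma>\<^sub>2 v) \<and>
    (\<forall>j\<in>{0..k}. planar_drawing G (\<Delta> j)) \<and>
    (\<forall>j\<in>{1..k}. unidirectional G (\<Delta> (j - 1)) (\<Delta> j) \<and> planar_linear_morph G (\<Delta> (j - 1)) (\<Delta> j))"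
proof -
  obtain \<Delta> where \<Delta>: "\<forall>v\<in>vertices G. \<Delta> 0 v = \<Gamma>\<^sub>1 v" "\<forall>v\<in>vertices G. \<Delta> k v = \<Gamma>\<^sub>2 v"
    "\<forall>j\<le>k. planar_drawing G (\<Delta> j)"
    "\<forall>j<k. unidirectional G (\<Delta> j) (\<Delta> (Suc j)) \<and> planar_linear_morph G (\<Delta> j) (\<Delta> (Suc j))"
    using pseudo_morph_imp_morphs[OF assms(1,2,4,5)] unfolding assms(6) morphs_def by blast
  have "unidirectional G (\<Delta> (j - 1)) (\<Delta> j) \<and> planar_linear_morph G (\<Delta> (j - 1)) (\<Delta> j)"
    if "j \<in> {1..k}" for j
    using \<Delta>(4) that by (cases j) auto
  with \<Delta>(1-3) show ?thesis by (intro exI[of _ \<Delta>]) auto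
qed

end
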